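(* There exists an approximable graded $\mathbb{C}$-algebra $B=\bigoplus_{n\ge 0} B_n$ which is non-sectional, i.e. such that there do not exist a projective variety $X$ over $\mathbb{C}$, a big line bundle $L$ on $X$, and an injective homomorphism of graded $\mathbb{C}$-algebras $B\hookrightarrow R(L)=\bigoplus_{n\ge 0} H^0(X,nL)$.
   Context: Everything is over $\mathbb{C}$; graded algebras are commutative and graded by the non-negative integers; varieties are integral. For a line bundle $L$, $nL$ denotes $L^{\otimes n}$, and $R(L)=\bigoplus_{n\ge 0}H^0(X,nL)$ is the graded section ring of $L$. A line bundle $L$ on a projective variety $X$ of dimension $d$ is big if $\mathrm{vol}(L)=\lim_{n\to\infty} \frac{d!\,\dim H^0(X,nL)}{n^d}>0$. Definition (approximable). A graded algebra $B=\bigoplus_{n\ge 0} B_n$ which is an integral domain is approximable if and only if: (1) all the graded pieces $B_n$ are finite-dimensional; (2) $B_n\neq 0$ for all sufficiently large $n$; (3) for any $\epsilon>0$ there exists $p_0$ such that for all $p\ge p_0$, $$\liminf_{n\to\infty}\frac{\dim\big(\mathrm{Im}(S^nB_p\to B_{np})\big)}{\dim(B_{np})}>1-\epsilon,$$ where $S^nB_p\to B_{np}$ is the multiplication map from the $n$-th symmetric power of $B_p$. *)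

theory Defs
  imports
    "HOL-Analysis.Abstract_Topology"
    "HOL-Library.Extended_Real"
    "HOL-Library.Poly_Mapping"
    "HOL-Computational_Algebra.Polynomial"
    "HOL-Computational_Algebra.Fraction_Field"
    "Jordan_Normal_Form.VS_Connect"
begin

section \<open>Graded complex algebras\<close>

abbreviation complex_field :: "complex ring" where
  "complex_field \<equiv> class_ring"

definition cdim :: "(complex, 'a, 'm) module_scheme \<Rightarrow> 'a set \<Rightarrow> nat" where
  "cdim M W = vectorspace.dim complex_field (M\<lparr>carrier := W\<rparr>)"

definition cfin_dim :: "(complex, 'a, 'm) module_scheme \<Rightarrow> 'a set \<Rightarrow> bool" where
  "cfin_dim M W \<longleftrightarrow> vectorspace.fin_dim complex_field (M\<lparr>carrier := W\<rparr>)"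

text \<open>A commutative algebra \<open>B\<close> together with an internal direct sum decomposition
  \<open>B = (\<Oplus>n. gr n)\<close> compatible with the multiplication.\<close>

definition graded_algebra :: "(complex, 'a, 'm) module_scheme \<Rightarrow> (nat \<Rightarrow> 'a set) \<Rightarrow> bool" where
  "graded_algebra B gr \<longleftrightarrow>
     Module.algebra complex_field B \<and>
     (\<forall>n. VectorSpace.subspace complex_field (gr n) B) \<and>
     (\<forall>x\<in>carrier B. \<exists>!f. (\<forall>n. f n \<in> gr n) \<and> finite {n. f n \<noteq> \<zero>\<^bsub>B\<^esub>} \<and>
        x = finsum B f {n. f n \<noteq> \<zero>\<^bsub>B\<^esub>}) \<and>
     \<one>\<^bsub>B\<^esub> \<in> gr 0 \<and>
     (\<forall>m n. \<forall>x\<in>gr m. \<forall>y\<in>gr n. x \<otimes>\<^bsub>B\<^esub> y \<in> gr (m + n))"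

text \<open>The image of the multiplication map from the \<open>n\<close>-th symmetric power of \<open>W\<close>: the symmetric
  power is spanned by the classes of \<open>w\<^sub>0 \<otimes> \<dots> \<otimes> w\<^bsub>n-1\<^esub>\<close>, so its image is spanned by
  the products \<open>w\<^sub>0 \<cdots> w\<^bsub>n-1\<^esub>\<close> in \<open>B\<close>.\<close>

definition sym_power_image :: "(complex, 'a, 'm) module_scheme \<Rightarrow> nat \<Rightarrow> 'a set \<Rightarrow> 'a set" where
  "sym_power_image B n W =
     LinearCombinations.module.span complex_field B {finprod B w {..<n} | w. \<forall>i<n. w i \<in> W}"

definition approximable :: "(complex, 'a, 'm) module_scheme \<Rightarrow> (nat \<Rightarrow> 'a set) \<Rightarrow> bool" where
  "approximable B gr \<longleftrightarrow>
     graded_algebra B gr \<and> domain B \<and>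
     (\<forall>n. cfin_dim B (gr n)) \<and>
     (\<exists>n0. \<forall>n\<ge>n0. gr n \<noteq> {\<zero>\<^bsub>B\<^esub>}) \<and>
     (\<forall>\<epsilon>::real. \<epsilon> > 0 \<longrightarrow> (\<exists>p0. \<forall>p\<ge>p0.
        liminf (\<lambda>n. ereal (real (cdim B (sym_power_image B n (gr p))) / real (cdim B (gr (n * p)))))
          > ereal (1 - \<epsilon>)))"

definition graded_algebra_hom ::
    "(complex, 'a, 'm) module_scheme \<Rightarrow> (nat \<Rightarrow> 'a set) \<Rightarrow>
     (complex, 'b, 'k) module_scheme \<Rightarrow> (nat \<Rightarrow> 'b set) \<Rightarrow> ('a \<Rightarrow> 'b) set" where
  "graded_algebra_hom A grA B grB =
     {\<phi> \<in> Ring.ring_hom A B. (\<forall>c. \<forall>x\<in>carrier A. \<phi> (c \<odot>\<^bsub>A\<^esub> x) = c \<odot>\<^bsub>B\<^esub> \<phi> x) \<and>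
        (\<forall>n. \<phi> ` grA n \<subseteq> grB n)}"


section \<open>Homogeneous polynomials and projective space\<close>

text \<open>Polynomials have exponent vectors of type \<^typ>\<open>nat \<Rightarrow>\<^sub>0 nat\<close>.\<close>

type_synonym cpoly = "(nat \<Rightarrow>\<^sub>0 nat) \<Rightarrow>\<^sub>0 complex"

definition monom_eval :: "(nat \<Rightarrow> complex) \<Rightarrow> (nat \<Rightarrow>\<^sub>0 nat) \<Rightarrow> complex" where
  "monom_eval x m = (\<Prod>i\<in>Poly_Mapping.keys m. x i ^ Poly_Mapping.lookup m i)"

definition poly_eval :: "(nat \<Rightarrow> complex) \<Rightarrow> cpoly \<Rightarrow> complex" where
  "poly_eval x F = (\<Sum>m\<in>Poly_Mapping.keys F. Poly_Mapping.lookup F m * monom_eval x m)"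

definition monom_degree :: "(nat \<Rightarrow>\<^sub>0 nat) \<Rightarrow> nat" where
  "monom_degree m = (\<Sum>i\<in>Poly_Mapping.keys m. Poly_Mapping.lookup m i)"

text \<open>Homogeneous polynomials of degree \<open>d\<close> in the variables \<open>x\<^sub>0, \<dots>, x\<^sub>N\<close>
  (including the zero polynomial).\<close>

definition forms :: "nat \<Rightarrow> nat \<Rightarrow> cpoly set" where
  "forms N d = {F. \<forall>m\<in>Poly_Mapping.keys F. Poly_Mapping.keys m \<subseteq> {..N} \<and> monom_degree m = d}"

text \<open>A point of projective space is a line through the origin with the origin removed, i.e. the
  set of all its homogeneous coordinate vectors. Vectors in the \<open>(N+1)\<close>-dimensional space are
  functions vanishing beyond index \<open>N\<close>.\<close>

type_synonym proj_point = "(nat \<Rightarrow> complex) set"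

definition line_through :: "(nat \<Rightarrow> complex) \<Rightarrow> proj_point" where
  "line_through x = {\<lambda>i. c * x i | c. c \<noteq> 0}"

definition proj_space :: "nat \<Rightarrow> proj_point set" where
  "proj_space N = {line_through x | x. (\<exists>i. x i \<noteq> 0) \<and> (\<forall>i>N. x i = 0)}"

definition vanishes_at :: "cpoly \<Rightarrow> proj_point \<Rightarrow> bool" where
  "vanishes_at F p \<longleftrightarrow> (\<forall>x\<in>p. poly_eval x F = 0)"

definition zero_locus :: "nat \<Rightarrow> cpoly set \<Rightarrow> proj_point set" where
  "zero_locus N S = {p \<in> proj_space N. \<forall>F\<in>S. vanishes_at F p}"

definition zariski :: "nat \<Rightarrow> proj_point topology" where
  "zariski N = topology (\<lambda>U. \<exists>S \<subseteq> (\<Union>d. forms N d). U = proj_space N - zero_locus N S)"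

lemma monom_eval_superset:
  assumes "finite A" "Poly_Mapping.keys m \<subseteq> A"
  shows "monom_eval x m = (\<Prod>i\<in>A. x i ^ Poly_Mapping.lookup m i)"
  unfolding monom_eval_def using assms
  by (intro prod.mono_neutral_left) (auto simp: in_keys_iff)

lemma monom_eval_add: "monom_eval x (a + b) = monom_eval x a * monom_eval x b"
proof -
  let ?A = "Poly_Mapping.keys a \<union> Poly_Mapping.keys b"
  have "monom_eval x (a + b) = (\<Prod>i\<in>?A. x i ^ Poly_Mapping.lookup (a + b) i)"
    by (rule monom_eval_superset) (simp_all add: Poly_Mapping.keys_add)
  also have "\<dots> = (\<Prod>i\<in>?A. x i ^ Poly_Mapping.lookup a i) * (\<Prod>i\<in>?A. x i ^ Poly_Mapping.lookup b i)"
    by (simp add: lookup_add power_add prod.distrib)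
  finally show ?thesis by (simp add: monom_eval_superset[of ?A])
qed

lemma monom_degree_superset:
  assumes "finite A" "Poly_Mapping.keys m \<subseteq> A"
  shows "monom_degree m = (\<Sum>i\<in>A. Poly_Mapping.lookup m i)"
  unfolding monom_degree_def using assms
  by (intro sum.mono_neutral_left) (auto simp: in_keys_iff)

lemma monom_degree_add: "monom_degree (a + b) = monom_degree a + monom_degree b"
proof -
  let ?A = "Poly_Mapping.keys a \<union> Poly_Mapping.keys b"
  have "monom_degree (a + b) = (\<Sum>i\<in>?A. Poly_Mapping.lookup (a + b) i)"
    by (rule monom_degree_superset) (simp_all add: Poly_Mapping.keys_add)
  also have "\<dots> = (\<Sum>i\<in>?A. Poly_Mapping.lookup a i) + (\<Sum>i\<in>?A. Poly_Mapping.lookup b i)"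
    by (simp add: lookup_add sum.distrib)
  finally show ?thesis by (simp add: monom_degree_superset[of ?A])
qed

lemma poly_eval_superset:
  assumes "finite A" "Poly_Mapping.keys F \<subseteq> A"
  shows "poly_eval x F = (\<Sum>m\<in>A. Poly_Mapping.lookup F m * monom_eval x m)"
  unfolding poly_eval_def using assms
  by (intro sum.mono_neutral_left) (auto simp: in_keys_iff)

lemma poly_eval_add: "poly_eval x (F + G) = poly_eval x F + poly_eval x G"
proof -
  let ?A = "Poly_Mapping.keys F \<union> Poly_Mapping.keys G"
  have "poly_eval x (F + G) = (\<Sum>m\<in>?A. Poly_Mapping.lookup (F + G) m * monom_eval x m)"
    by (rule poly_eval_superset) (simp_all add: Poly_Mapping.keys_add)
  also have "\<dots> = (\<Sum>m\<in>?A. Poly_Mapping.lookup F m * monom_eval x m) + (\<Sum>m\<in>?A. Poly_Mapping.lookup G m * monom_eval x m)"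
    by (simp add: lookup_add algebra_simps sum.distrib)
  finally show ?thesis by (simp add: poly_eval_superset[of ?A])
qed

lemma poly_eval_0 [simp]: "poly_eval x 0 = 0"
  by (simp add: poly_eval_def)

lemma poly_eval_single: "poly_eval x (Poly_Mapping.single m c) = c * monom_eval x m"
  by (simp add: poly_eval_def)

lemma cpoly_induct [case_names zero single_add]:
  fixes F :: cpoly
  assumes "P 0" and "\<And>m c F. P F \<Longrightarrow> P (Poly_Mapping.single m c + F)"
  shows "P F"
proof -
  have "P (\<Sum>m\<in>A. Poly_Mapping.single m (Poly_Mapping.lookup F m))" if "finite A" for A
    using that by (induction A) (auto intro: assms)
  moreover have "(\<Sum>m\<in>Poly_Mapping.keys F. Poly_Mapping.single m (Poly_Mapping.lookup F m)) = F"
    by (rule poly_mapping_eqI)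
      (simp add: lookup_sum lookup_single when_def in_keys_iff)
  ultimately show ?thesis by (metis finite_keys)
qed

lemma poly_eval_single_mult:
  "poly_eval x (Poly_Mapping.single m c * G) = c * monom_eval x m * poly_eval x G"
  by (induction G rule: cpoly_induct)
    (auto simp: distrib_left poly_eval_add poly_eval_single mult_single monom_eval_add)

lemma poly_eval_mult: "poly_eval x (F * G) = poly_eval x F * poly_eval x G"
  by (induction F rule: cpoly_induct)
    (auto simp: distrib_right poly_eval_add poly_eval_single poly_eval_single_mult)

lemma forms_mult: "F \<in> forms N d \<Longrightarrow> G \<in> forms N e \<Longrightarrow> F * G \<in> forms N (d + e)"
proof -
  assume F: "F \<in> forms N d" and G: "G \<in> forms N e"
  have "Poly_Mapping.keys m \<subseteq> {..N} \<and> monom_degree m = d + e"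
    if m: "m \<in> Poly_Mapping.keys (F * G)" for m
  proof -
    obtain a b where ab: "m = a + b" "a \<in> Poly_Mapping.keys F" "b \<in> Poly_Mapping.keys G"
      using keys_mult[of F G] m by blast
    then have "Poly_Mapping.keys a \<subseteq> {..N}" "monom_degree a = d"
      "Poly_Mapping.keys b \<subseteq> {..N}" "monom_degree b = e"
      using F G by (simp_all add: forms_def)
    then show ?thesis
      using Poly_Mapping.keys_add[of a b] ab(1) by (auto simp: monom_degree_add)
  qed
  then show ?thesis by (simp add: forms_def)
qed

lemma monom_eval_scale: "monom_eval (\<lambda>i. c * x i) m = c ^ monom_degree m * monom_eval x m"
  by (simp add: monom_eval_def monom_degree_def power_mult_distrib prod.distrib power_sum)

lemma poly_eval_scale:
  "F \<in> forms N d \<Longrightarrow> poly_eval (\<lambda>i. c * x i) F = c ^ d * poly_eval x F"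
  by (simp add: forms_def poly_eval_def monom_eval_scale sum_distrib_left mult.left_commute)

lemma vanishes_at_line_through:
  assumes "F \<in> forms N d"
  shows "vanishes_at F (line_through x) \<longleftrightarrow> poly_eval x F = 0"
proof
  have "x \<in> line_through x" by (auto simp: line_through_def intro: exI[of _ 1])
  then show "vanishes_at F (line_through x) \<Longrightarrow> poly_eval x F = 0"
    by (simp add: vanishes_at_def)
qed (auto simp: vanishes_at_def line_through_def poly_eval_scale[OF assms])

lemma vanishes_at_mult:
  assumes "F \<in> forms N d" "G \<in> forms N e" "p \<in> proj_space N"
  shows "vanishes_at (F * G) p \<longleftrightarrow> vanishes_at F p \<or> vanishes_at G p"
  using assms
  by (auto simp: proj_space_def vanishes_at_line_through[OF assms(1)]
      vanishes_at_line_through[OF assms(2)] vanishes_at_line_through[OF forms_mult[OF assms(1,2)]]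
      poly_eval_mult)

lemma openin_zariski:
  "openin (zariski N) U \<longleftrightarrow> (\<exists>S \<subseteq> (\<Union>d. forms N d). U = proj_space N - zero_locus N S)"
proof -
  let ?L = "\<lambda>U. \<exists>S \<subseteq> (\<Union>d. forms N d). U = proj_space N - zero_locus N S"
  have "istopology ?L"
    unfolding istopology_def
  proof (intro conjI allI impI)
    fix U V assume "?L U" "?L V"
    then obtain S T where S: "S \<subseteq> (\<Union>d. forms N d)" "U = proj_space N - zero_locus N S"
      and T: "T \<subseteq> (\<Union>d. forms N d)" "V = proj_space N - zero_locus N T" by blast
    let ?R = "{F * G | F G. F \<in> S \<and> G \<in> T}"
    have "?R \<subseteq> (\<Union>d. forms N d)"
    proof
      fix H assume "H \<in> ?R"
      then obtain F G where FG: "H = F * G" "F \<in> S" "G \<in> T" by auto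
      obtain d where "F \<in> forms N d" using FG(2) S(1) by auto
      moreover obtain e where "G \<in> forms N e" using FG(3) T(1) by auto
      ultimately have "H \<in> forms N (d + e)" unfolding FG(1) by (rule forms_mult)
      then show "H \<in> (\<Union>d. forms N d)" by auto
    qed
    moreover have van: "vanishes_at (F * G) p \<longleftrightarrow> vanishes_at F p \<or> vanishes_at G p"
      if FG: "F \<in> S" "G \<in> T" "p \<in> proj_space N" for F G p
    proof -
      obtain d where "F \<in> forms N d" using FG(1) S(1) by auto
      moreover obtain e where "G \<in> forms N e" using FG(2) T(1) by auto
      ultimately show ?thesis using FG(3) by (rule vanishes_at_mult)
    qed
    have "U \<inter> V = proj_space N - zero_locus N ?R"
    proof (rule Set.set_eqI)
      fix p
      have "p \<in> zero_locus N ?R \<longleftrightarrow> p \<in> zero_locus N S \<or> p \<in> zero_locus N T"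
        if p: "p \<in> proj_space N"
      proof -
        have "(\<forall>H\<in>?R. vanishes_at H p) \<longleftrightarrow> (\<forall>F\<in>S. \<forall>G\<in>T. vanishes_at (F * G) p)"
          by blast
        also have "\<dots> \<longleftrightarrow> (\<forall>F\<in>S. \<forall>G\<in>T. vanishes_at F p \<or> vanishes_at G p)"
          using van p by simp
        finally show ?thesis using p by (auto simp: zero_locus_def)
      qed
      then show "p \<in> U \<inter> V \<longleftrightarrow> p \<in> proj_space N - zero_locus N ?R"
        using S(2) T(2) by blast
    qed
    ultimately show "?L (U \<inter> V)" by blast
  next
    fix K assume "\<forall>U\<in>K. ?L U"
    then obtain S where S: "\<And>U. U \<in> K \<Longrightarrow> S U \<subseteq> (\<Union>d. forms N d) \<and> U = proj_space N - zero_locus N (S U)"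
      by metis
    have "p \<in> \<Union>K \<longleftrightarrow> p \<in> proj_space N - zero_locus N (\<Union>U\<in>K. S U)" for p
    proof -
      have "p \<in> \<Union>K \<longleftrightarrow> (\<exists>U\<in>K. p \<in> proj_space N - zero_locus N (S U))"
        using S by auto
      then show ?thesis by (auto simp: zero_locus_def)
    qed
    then have "\<Union>K = proj_space N - zero_locus N (\<Union>U\<in>K. S U)"
      by (rule Set.set_eqI)
    moreover have "(\<Union>U\<in>K. S U) \<subseteq> (\<Union>d. forms N d)" using S by blast
    ultimately show "?L (\<Union>K)" by blast
  qed
  then show ?thesis by (simp add: zariski_def topology_inverse')
qed


section \<open>Projective varieties and line bundles\<close>

definition irreducible_in :: "'a topology \<Rightarrow> 'a set \<Rightarrow> bool" where
  "irreducible_in T Z \<longleftrightarrow> Z \<noteq> {} \<and> Z \<subseteq> topspace T \<and>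
     (\<forall>A B. closedin T A \<longrightarrow> closedin T B \<longrightarrow> Z \<subseteq> A \<union> B \<longrightarrow> Z \<subseteq> A \<or> Z \<subseteq> B)"

definition projective_variety :: "nat \<Rightarrow> proj_point set \<Rightarrow> bool" where
  "projective_variety N X \<longleftrightarrow> closedin (zariski N) X \<and> irreducible_in (zariski N) X"

text \<open>The Krull dimension; the set of chain lengths is bounded (by \<open>N\<close>), so its supremum is its
  maximum.\<close>

definition variety_dim :: "nat \<Rightarrow> proj_point set \<Rightarrow> nat" where
  "variety_dim N X = Sup {n. \<exists>Z :: nat \<Rightarrow> proj_point set.
     (\<forall>i\<le>n. closedin (zariski N) (Z i) \<and> irreducible_in (zariski N) (Z i) \<and> Z i \<subseteq> X) \<and>
     (\<forall>i<n. Z i \<subset> Z (Suc i))}"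

definition regular_on :: "nat \<Rightarrow> proj_point set \<Rightarrow> proj_point set \<Rightarrow> (proj_point \<Rightarrow> complex) \<Rightarrow> bool" where
  "regular_on N X U f \<longleftrightarrow> (\<forall>p\<in>U. \<exists>W d. \<exists>F\<in>forms N d. \<exists>G\<in>forms N d.
     openin (subtopology (zariski N) X) W \<and> p \<in> W \<and> W \<subseteq> U \<and>
     (\<forall>q\<in>W. \<forall>x\<in>q. poly_eval x G \<noteq> 0 \<and> f q = poly_eval x F / poly_eval x G))"

text \<open>A line bundle is given by an open cover on whose members it is trivialised, together with its
  transition functions. A section has local components \<open>s i\<close> with \<open>s i = trans i j * s j\<close> on
  overlaps. By quasi-compactness covers indexed by natural numbers suffice.\<close>

record line_bundle_data =
  cover_index :: "nat set"
  cover_set :: "nat \<Rightarrow> proj_point set"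
  trans_fun :: "nat \<Rightarrow> nat \<Rightarrow> proj_point \<Rightarrow> complex"

definition line_bundle :: "nat \<Rightarrow> proj_point set \<Rightarrow> line_bundle_data \<Rightarrow> bool" where
  "line_bundle N X L \<longleftrightarrow>
     (\<forall>i\<in>cover_index L. openin (subtopology (zariski N) X) (cover_set L i)) \<and>
     (\<Union>i\<in>cover_index L. cover_set L i) = X \<and>
     (\<forall>i\<in>cover_index L. \<forall>j\<in>cover_index L.
        regular_on N X (cover_set L i \<inter> cover_set L j) (trans_fun L i j) \<and>
        (\<forall>p\<in>cover_set L i \<inter> cover_set L j. trans_fun L i j p \<noteq> 0)) \<and>
     (\<forall>i\<in>cover_index L. \<forall>j\<in>cover_index L. \<forall>k\<in>cover_index L.
        \<forall>p\<in>cover_set L i \<inter> cover_set L j \<inter> cover_set L k.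
          trans_fun L i j p * trans_fun L j k p = trans_fun L i k p)"

definition tensor_power :: "nat \<Rightarrow> line_bundle_data \<Rightarrow> line_bundle_data" where
  "tensor_power n L = L\<lparr>trans_fun := \<lambda>i j p. trans_fun L i j p ^ n\<rparr>"

text \<open>Local components are normalised to be zero outside their domain, so that equal sections are
  equal as functions.\<close>

type_synonym section_data = "nat \<Rightarrow> proj_point \<Rightarrow> complex"

definition global_sections :: "nat \<Rightarrow> proj_point set \<Rightarrow> line_bundle_data \<Rightarrow> section_data set" where
  "global_sections N X L = {s.
     (\<forall>i p. i \<notin> cover_index L \<or> p \<notin> cover_set L i \<longrightarrow> s i p = 0) \<and>
     (\<forall>i\<in>cover_index L. regular_on N X (cover_set L i) (s i)) \<and>
     (\<forall>i\<in>cover_index L. \<forall>j\<in>cover_index L. \<forall>p\<in>cover_set L i \<inter> cover_set L j.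
        s i p = trans_fun L i j p * s j p)}"

text \<open>Only the vector space structure is meaningful here; the multiplicative fields are dummies.\<close>

definition H0 :: "nat \<Rightarrow> proj_point set \<Rightarrow> line_bundle_data \<Rightarrow> (complex, section_data) module" where
  "H0 N X L = \<lparr>carrier = global_sections N X L,
     mult = (\<lambda>s t i p. 0), one = (\<lambda>i p. 0), zero = (\<lambda>i p. 0),
     add = (\<lambda>s t i p. s i p + t i p), smult = (\<lambda>c s i p. c * s i p)\<rparr>"

definition section_ring ::
    "nat \<Rightarrow> proj_point set \<Rightarrow> line_bundle_data \<Rightarrow> (complex, nat \<Rightarrow> section_data) module" where
  "section_ring N X L = \<lparr>
     carrier = {s. (\<forall>n. s n \<in> global_sections N X (tensor_power n L)) \<and>
                   finite {n. s n \<noteq> (\<lambda>i p. 0)}},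
     mult = (\<lambda>s t n i p. \<Sum>k\<le>n. s k i p * t (n - k) i p),
     one = (\<lambda>n i p. if n = 0 \<and> i \<in> cover_index L \<and> p \<in> cover_set L i then 1 else 0),
     zero = (\<lambda>n i p. 0),
     add = (\<lambda>s t n i p. s n i p + t n i p),
     smult = (\<lambda>c s n i p. c * s n i p)\<rparr>"

definition section_ring_gr ::
    "nat \<Rightarrow> proj_point set \<Rightarrow> line_bundle_data \<Rightarrow> nat \<Rightarrow> (nat \<Rightarrow> section_data) set" where
  "section_ring_gr N X L n = {s \<in> carrier (section_ring N X L). \<forall>m. m \<noteq> n \<longrightarrow> s m = (\<lambda>i p. 0)}"

definition has_volume :: "nat \<Rightarrow> proj_point set \<Rightarrow> line_bundle_data \<Rightarrow> real \<Rightarrow> bool" where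
  "has_volume N X L v \<longleftrightarrow>
     (\<lambda>n. fact (variety_dim N X) *
            real (vectorspace.dim complex_field (H0 N X (tensor_power n L))) /
            real n ^ variety_dim N X) \<longlonglongrightarrow> v"

definition big :: "nat \<Rightarrow> proj_point set \<Rightarrow> line_bundle_data \<Rightarrow> bool" where
  "big N X L \<longleftrightarrow> (\<exists>v>0. has_volume N X L v)"

end

theory Submission
  imports Defs
    "HOL-Library.Function_Algebras"
    "HOL-Computational_Algebra.Fundamental_Theorem_Algebra"
begin

text \<open>The algebra is \<open>B = \<Oplus>\<^sub>n H\<^sup>0(P\<^sup>1, \<lfloor>n D\<rfloor>)\<close> for the divisor of infinite support
  \<open>D = [\<infinity>] + \<Sum>\<^sub>i 2\<^sup>-\<^sup>i [i]\<close>, of degree \<open>3\<close>. The image of \<open>S\<^sup>n B\<^sub>p\<close> consists of the sections of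
  \<open>n \<lfloor>p D\<rfloor>\<close>, so approximability says that \<open>deg \<lfloor>p D\<rfloor> / p\<close> tends to \<open>deg D\<close>.

  Suppose \<open>B\<close> embeds in \<open>R(L)\<close>, and let the sections \<open>s\<close> and \<open>u\<close> of \<open>L\<close> be the images of \<open>1\<close> and \<open>x\<close>
  in degree one. The image \<open>\<sigma>\<close> of \<open>1/(x - i)\<close> in degree \<open>2\<^sup>i\<close> satisfies \<open>(u - i s) \<sigma> = s ^ (2 ^ i + 1)\<close>,
  so the regular function \<open>u / s\<close> on the nonempty open set \<open>s \<noteq> 0\<close> omits every natural number. A
  nonconstant regular function on a variety omits only finitely many values, because homomorphisms
  to the complex numbers extend generically along finitely generated extensions of domains.
  Hence \<open>u = c s\<close> for a constant \<open>c\<close>, contradicting injectivity.\<close>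

section \<open>Generic extension of homomorphisms\<close>

text \<open>The weights \<open>2^-i\<close> meet two opposing demands: their sum is finite, which
  bounds the degree of floor(n D) by 3 n, yet infinitely many of them are positive, which makes
  every natural number an omitted value. The summand at infinity puts \<open>x\<close> next to
  \<open>1\<close> in degree one.

  The count of omitted values is Chevalley's theorem for a map f = P / Q from an affine chart to the
  line. A number \<open>a\<close> is the homomorphism from C[f] to C with f |-> a; extended to
  C[f, x_0, ..., x_N], it yields the coordinates of a point with f = a. The extension adds one
  generator at a time: a transcendental generator can go almost anywhere, an algebraic one goes to a
  root of its minimal polynomial. At each stage the nonvanishing of a single nonzero element of the
  smaller ring suffices, so in the end only the roots of one polynomial in \<open>a\<close> are
  exceptional. The same element keeps a chosen function nonzero, so that the point found stays in
  the open chart.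

  All this happens in one trivialising chart; irreducibility then spreads the proportionality of
  \<open>u\<close> and \<open>s\<close> to all of \<open>X\<close>.\<close>

definition subrng :: "'r::comm_ring_1 set \<Rightarrow> bool" where
  "subrng A \<longleftrightarrow> 0 \<in> A \<and> (\<forall>a\<in>A. \<forall>b\<in>A. a - b \<in> A \<and> a * b \<in> A)"

definition no_zero_div :: "'r::comm_ring_1 set \<Rightarrow> bool" where
  "no_zero_div A \<longleftrightarrow> (\<forall>a\<in>A. \<forall>b\<in>A. a * b = 0 \<longrightarrow> a = 0 \<or> b = 0)"

definition polys :: "'r::comm_ring_1 set \<Rightarrow> 'r poly set" where
  "polys A = {p. \<forall>i. Polynomial.coeff p i \<in> A}"

definition adjoin :: "'r::comm_ring_1 set \<Rightarrow> 'r \<Rightarrow> 'r set" where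
  "adjoin A y = (\<lambda>p. poly p y) ` polys A"

text \<open>The zero map qualifies; where it matters, it is excluded by conditions such as
  \<open>\<psi> h \<noteq> 0\<close>.\<close>

definition rng_hom :: "'r::comm_ring_1 set \<Rightarrow> ('r \<Rightarrow> 's::comm_ring_1) \<Rightarrow> bool" where
  "rng_hom A \<psi> \<longleftrightarrow> (\<forall>a\<in>A. \<forall>b\<in>A. \<psi> (a + b) = \<psi> a + \<psi> b \<and> \<psi> (a * b) = \<psi> a * \<psi> b)"

lemma subrng_0: "subrng A \<Longrightarrow> 0 \<in> A"
  and subrng_diff: "subrng A \<Longrightarrow> a \<in> A \<Longrightarrow> b \<in> A \<Longrightarrow> a - b \<in> A"
  and subrng_mult: "subrng A \<Longrightarrow> a \<in> A \<Longrightarrow> b \<in> A \<Longrightarrow> a * b \<in> A"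
  by (auto simp: subrng_def)

lemma subrng_uminus: "subrng A \<Longrightarrow> a \<in> A \<Longrightarrow> - a \<in> A"
  using subrng_diff[of A 0 a] subrng_0[of A] by simp

lemma subrng_add: "subrng A \<Longrightarrow> a \<in> A \<Longrightarrow> b \<in> A \<Longrightarrow> a + b \<in> A"
  using subrng_diff[of A a "- b"] subrng_uminus[of A b] by simp

text \<open>Positive exponents only, because \<open>a ^ 0\<close> is the unit of the ambient ring
  and may lie outside \<open>A\<close>. Hence the \<open>Suc k\<close> in the pseudo-divisions
  below.\<close>

lemma subrng_power: "subrng A \<Longrightarrow> a \<in> A \<Longrightarrow> a ^ Suc n \<in> A"
  by (induction n) (auto simp: subrng_mult)

lemma subrng_sum: "subrng A \<Longrightarrow> (\<And>i. i \<in> I \<Longrightarrow> f i \<in> A) \<Longrightarrow> sum f I \<in> A"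
  by (induction I rule: infinite_finite_induct) (auto simp: subrng_0 subrng_add)

lemma no_zero_div_power: "subrng A \<Longrightarrow> no_zero_div A \<Longrightarrow> a \<in> A \<Longrightarrow> a \<noteq> 0 \<Longrightarrow> a ^ Suc n \<noteq> 0"
proof (induction n)
  case (Suc n)
  then show ?case using subrng_power[of A a n] unfolding no_zero_div_def power_Suc[of a "Suc n"] by blast
qed simp

lemma polysD: "p \<in> polys A \<Longrightarrow> Polynomial.coeff p i \<in> A"
  by (simp add: polys_def)

lemma subrng_polys:
  assumes "subrng A" shows "subrng (polys A)"
  unfolding subrng_def
  using assms by (auto simp: polys_def coeff_mult subrng_0 subrng_diff intro!: subrng_sum subrng_mult)

lemma monom_polys: "subrng A \<Longrightarrow> c \<in> A \<Longrightarrow> Polynomial.monom c n \<in> polys A"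
  by (simp add: polys_def subrng_0)

lemma const_polys: "subrng A \<Longrightarrow> c \<in> A \<Longrightarrow> [:c:] \<in> polys A"
  using monom_polys[of A c 0] by (simp add: monom_0)

lemma smult_polys: "subrng A \<Longrightarrow> c \<in> A \<Longrightarrow> p \<in> polys A \<Longrightarrow> Polynomial.smult c p \<in> polys A"
  by (simp add: polys_def subrng_mult)

lemma subrng_adjoin:
  assumes "subrng A" shows "subrng (adjoin A y)"
  unfolding subrng_def adjoin_def
proof (intro conjI ballI)
  note P = subrng_polys[OF assms]
  show "0 \<in> (\<lambda>p. poly p y) ` polys A" using subrng_0[OF P] by (auto intro: image_eqI[of _ _ 0])
  fix a b assume "a \<in> (\<lambda>p. poly p y) ` polys A" "b \<in> (\<lambda>p. poly p y) ` polys A"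
  then obtain p q where pq: "p \<in> polys A" "q \<in> polys A" "a = poly p y" "b = poly q y" by auto
  show "a - b \<in> (\<lambda>p. poly p y) ` polys A"
    using subrng_diff[OF P pq(1,2)] by (rule rev_image_eqI) (simp add: pq)
  show "a * b \<in> (\<lambda>p. poly p y) ` polys A"
    using subrng_mult[OF P pq(1,2)] by (rule rev_image_eqI) (simp add: pq)
qed

lemma adjoinI: "p \<in> polys A \<Longrightarrow> poly p y \<in> adjoin A y"
  by (auto simp: adjoin_def)

lemma adjoin_superset: "subrng A \<Longrightarrow> A \<subseteq> adjoin A y"
  using adjoinI[OF const_polys] by fastforce

lemma adjoin_subset:
  assumes A: "A \<subseteq> R" and R: "subrng R" and y: "y \<in> R"
  shows "adjoin A y \<subseteq> R"
proof -
  have "poly p y \<in> R" if "p \<in> polys A" for p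
    using that
  proof (induction p)
    case (pCons a p)
    have "Polynomial.coeff (pCons a p) 0 \<in> A" "\<And>i. Polynomial.coeff (pCons a p) (Suc i) \<in> A"
      using pCons.prems unfolding polys_def by blast+
    then have "a \<in> A" "p \<in> polys A" by (auto simp: polys_def)
    then show ?case using pCons.IH A by (auto intro!: subrng_add[OF R] subrng_mult[OF R] y)
  qed (simp add: subrng_0 R)
  then show ?thesis by (auto simp: adjoin_def)
qed

section \<open>Pseudo-division and minimal polynomials over a domain\<close>

lemma no_zero_div_subset: "no_zero_div B \<Longrightarrow> A \<subseteq> B \<Longrightarrow> no_zero_div A"
  by (auto simp: no_zero_div_def)

text \<open>The ambient ring may have zero divisors, but the leading coefficients lie in
  \<open>A\<close>, so their product does not vanish.\<close>

lemma lead_coeff_mult_nonzero: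
  assumes "no_zero_div A" "p \<in> polys A" "q \<in> polys A" "p \<noteq> 0" "q \<noteq> 0"
  shows "degree (p * q) = degree p + degree q" "p * q \<noteq> 0"
proof -
  have "lead_coeff p * lead_coeff q \<noteq> 0"
    using assms(1,4,5) polysD[OF assms(2)] polysD[OF assms(3)]
    by (metis no_zero_div_def leading_coeff_0_iff)
  then have *: "Polynomial.coeff (p * q) (degree p + degree q) \<noteq> 0"
    by (simp add: coeff_mult_degree_sum)
  then show "p * q \<noteq> 0" by auto
  show "degree (p * q) = degree p + degree q"
    using le_degree[OF *] degree_mult_le[of p q] by simp
qed

text \<open>Each cancellation of a leading term of \<open>f\<close> against \<open>g\<close> costs
  one factor \<open>lead_coeff g\<close>, since \<open>A\<close> does not allow division.\<close>

lemma pseudo_division: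
  assumes A: "subrng A" and g: "g \<in> polys A" "degree g > 0" and f: "f \<in> polys A"
  shows "\<exists>k. \<exists>q\<in>polys A. \<exists>r\<in>polys A.
    Polynomial.smult (lead_coeff g ^ Suc k) f = q * g + r \<and> degree r < degree g"
  using f
proof (induction "degree f" arbitrary: f rule: less_induct)
  case less
  note P = subrng_polys[OF A]
  let ?c = "lead_coeff g"
  have c: "?c \<in> A" using g by (simp add: polysD)
  show ?case
  proof (cases "degree f < degree g")
    case True
    have "Polynomial.smult (?c ^ Suc 0) f = 0 * g + Polynomial.smult ?c f" by simp
    moreover have "degree (Polynomial.smult ?c f) < degree g"
      using True degree_smult_le[of ?c f] by linarith
    ultimately show ?thesis
      using smult_polys[OF A c less.prems] subrng_0[OF P] by blast
  next
    case False
    define m where "m = Polynomial.monom (lead_coeff f) (degree f - degree g)"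
    define f' where "f' = Polynomial.smult ?c f - m * g"
    have m: "m \<in> polys A" unfolding m_def using less.prems by (intro monom_polys A polysD)
    have f': "f' \<in> polys A" unfolding f'_def
      by (intro subrng_diff[OF P] smult_polys[OF A] subrng_mult[OF P] c m g less.prems)
    have le: "degree f' \<le> degree f" unfolding f'_def m_def
    proof (rule degree_diff_le)
      show "degree (Polynomial.smult ?c f) \<le> degree f" by (rule degree_smult_le)
      have "degree (Polynomial.monom (lead_coeff f) (degree f - degree g) * g)
        \<le> degree f - degree g + degree g"
        by (rule order_trans[OF degree_mult_le]) (simp add: degree_monom_le)
      then show "degree (Polynomial.monom (lead_coeff f) (degree f - degree g) * g) \<le> degree f"
        using False by simp
    qed
    have "Polynomial.coeff f' (degree f) = 0" unfolding f'_def m_def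
      using False by (simp add: coeff_monom_mult)
    \<comment> \<open>If \<open>f'\<close> is zero, its degree 0 is still smaller, because
      \<open>degree f \<ge> degree g > 0\<close>.\<close>
    then have lt: "degree f' < degree f"
      using le False g(2) by (metis degree_0 leading_coeff_0_iff le_neq_implies_less less_le_trans not_less)
    obtain k q r where IH: "q \<in> polys A" "r \<in> polys A"
      "Polynomial.smult (?c ^ Suc k) f' = q * g + r" "degree r < degree g"
      using less.hyps[OF lt f'] by blast
    have "Polynomial.smult (?c ^ Suc (Suc k)) f
      = Polynomial.smult (?c ^ Suc k) f' + Polynomial.smult (?c ^ Suc k) (m * g)"
      unfolding f'_def by (simp add: smult_diff_right mult.commute)
    also have "\<dots> = (q + Polynomial.smult (?c ^ Suc k) m) * g + r"
      unfolding IH(3) by (simp add: algebra_simps)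
    finally show ?thesis
      using IH(2,4) subrng_add[OF P IH(1) smult_polys[OF A subrng_power[OF A c] m], of k]
      by blast
  qed
qed

text \<open>Euclid's algorithm modulo the minimal polynomial: dividing \<open>p\<close> by
  \<open>q\<close> leaves a remainder \<open>s\<close> of smaller degree with s(y) = - q'(y) q(y),
  so a multiplier \<open>u\<close> for \<open>s\<close> gives the multiplier - u q' for
  \<open>q\<close>. Thus q(y) is invertible up to an element of \<open>A\<close>.\<close>

lemma minimal_polynomial_inverts:
  assumes A: "subrng A" and B: "no_zero_div (adjoin A y)"
    and p: "p \<in> polys A" "p \<noteq> 0" "poly p y = 0"
    and min: "\<And>q. q \<in> polys A \<Longrightarrow> q \<noteq> 0 \<Longrightarrow> poly q y = 0 \<Longrightarrow> degree p \<le> degree q"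
    and q: "q \<in> polys A" "q \<noteq> 0" "degree q < degree p"
  shows "\<exists>u\<in>polys A. \<exists>h\<in>A. h \<noteq> 0 \<and> poly u y * poly q y = h"
  using q
proof (induction "degree q" arbitrary: q rule: less_induct)
  case less
  note P = subrng_polys[OF A]
  have nzA: "no_zero_div A" using no_zero_div_subset[OF B adjoin_superset[OF A]] .
  show ?case
  proof (cases "degree q = 0")
    case True
    then obtain c where c: "q = [:c:]" by (rule degree_eq_zeroE)
    then have "c \<in> A" "c \<noteq> 0" using less.prems polysD[of q A 0] by auto
    \<comment> \<open>The multiplier is \<open>c\<close> and not 1, which need not lie in
      \<open>A\<close>.\<close>
    moreover have "poly [:c:] y * poly q y = c * c" by (simp add: c)
    moreover have "c * c \<noteq> 0" using nzA calculation by (auto simp: no_zero_div_def)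
    ultimately show ?thesis using const_polys[OF A] subrng_mult[OF A] by blast
  next
    case False
    let ?c = "lead_coeff q"
    obtain k q' s where d: "q' \<in> polys A" "s \<in> polys A"
      "Polynomial.smult (?c ^ Suc k) p = q' * q + s" "degree s < degree q"
      using pseudo_division[OF A less.prems(1) _ p(1)] False by blast
    have cA: "?c ^ Suc k \<in> A" using less.prems by (intro subrng_power A polysD)
    have c0: "?c ^ Suc k \<noteq> 0"
      using less.prems by (intro no_zero_div_power[OF A nzA] polysD) auto
    have ev: "poly q' y * poly q y + poly s y = 0"
      using arg_cong[OF d(3), of "\<lambda>p. poly p y"] p(3) by simp
    \<comment> \<open>Otherwise \<open>y\<close> is a root of \<open>q\<close> or of
      \<open>q'\<close>. Both have degree below that of \<open>p\<close>: the first by assumption,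
      the second because the degrees of \<open>q'\<close> and \<open>q\<close> add up to at most
      \<open>degree p\<close>. This contradicts minimality.\<close>
    have "s \<noteq> 0"
    proof
      assume s: "s = 0"
      have "?c ^ Suc k * lead_coeff p \<noteq> 0"
        using nzA cA c0 p(2) polysD[OF p(1)] by (metis no_zero_div_def leading_coeff_0_iff)
      then have "Polynomial.smult (?c ^ Suc k) p \<noteq> 0"
        by (metis coeff_0 coeff_smult)
      then have q'0: "q' \<noteq> 0" using d(3) s by auto
      have "poly q y \<noteq> 0" using min[OF less.prems(1,2)] less.prems(3) by auto
      then have "poly q' y = 0"
        using ev B s adjoinI[OF d(1)] adjoinI[OF less.prems(1)] by (auto simp: no_zero_div_def)
      then have "degree p \<le> degree q'" using min d(1) q'0 by blast
      moreover have "degree q' + degree q \<le> degree p"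
        using lead_coeff_mult_nonzero(1)[OF nzA d(1) less.prems(1) q'0 less.prems(2)]
          d(3) s degree_smult_le[of "?c ^ Suc k" p] by simp
      ultimately show False using False by simp
    qed
    then obtain u h where u: "u \<in> polys A" "h \<in> A" "h \<noteq> 0" "poly u y * poly s y = h"
      using less.hyps[OF d(4,2)] d(4) less.prems(3) by auto
    have "poly s y = - (poly q' y * poly q y)"
      using ev by (simp add: eq_neg_iff_add_eq_0 add.commute)
    then have "poly (- (u * q')) y * poly q y = h"
      using u(4) by (simp add: mult.assoc)
    then show ?thesis
      using u(2,3) subrng_uminus[OF P subrng_mult[OF P u(1) d(1)]] by blast
  qed
qed

section \<open>Extension of a homomorphism by one generator\<close>

lemma rng_hom_0: "subrng A \<Longrightarrow> rng_hom A \<psi> \<Longrightarrow> \<psi> 0 = 0"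
  unfolding rng_hom_def by (metis add_cancel_right_right subrng_0)

lemma rng_hom_sum:
  assumes "subrng A" "rng_hom A \<psi>" "\<And>i. i \<in> I \<Longrightarrow> f i \<in> A"
  shows "\<psi> (sum f I) = (\<Sum>i\<in>I. \<psi> (f i))"
  using assms(3)
proof (induction I rule: infinite_finite_induct)
  case (insert x F)
  then have "sum f F \<in> A" "f x \<in> A" using assms(1) by (auto intro: subrng_sum)
  then show ?case using insert assms(2) by (simp add: rng_hom_def)
qed (auto simp: rng_hom_0[OF assms(1,2)])

lemma map_poly_rng_hom:
  assumes A: "subrng A" "rng_hom A \<psi>" and p: "p \<in> polys A" "q \<in> polys A"
  shows "map_poly \<psi> (p + q) = map_poly \<psi> p + map_poly \<psi> q"
    and "map_poly \<psi> (p * q) = map_poly \<psi> p * map_poly \<psi> q"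
proof -
  note 0 = rng_hom_0[OF A]
  show "map_poly \<psi> (p + q) = map_poly \<psi> p + map_poly \<psi> q"
    using p A(2) by (intro poly_eqI) (simp add: coeff_map_poly 0 rng_hom_def polysD)
  show "map_poly \<psi> (p * q) = map_poly \<psi> p * map_poly \<psi> q"
  proof (rule poly_eqI)
    fix n
    have "\<psi> (\<Sum>i\<le>n. Polynomial.coeff p i * Polynomial.coeff q (n - i))
      = (\<Sum>i\<le>n. \<psi> (Polynomial.coeff p i * Polynomial.coeff q (n - i)))"
      using p by (intro rng_hom_sum[OF A] subrng_mult[OF A(1)] polysD)
    also have "\<dots> = (\<Sum>i\<le>n. \<psi> (Polynomial.coeff p i) * \<psi> (Polynomial.coeff q (n - i)))"
      using p A(2) by (simp add: rng_hom_def polysD)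
    finally show "Polynomial.coeff (map_poly \<psi> (p * q)) n
      = Polynomial.coeff (map_poly \<psi> p * map_poly \<psi> q) n"
      by (simp add: coeff_map_poly 0 coeff_mult)
  qed
qed

text \<open>\<open>adjoin A y\<close> is the quotient of \<open>polys A\<close> by the relations of
  \<open>y\<close>, so a value \<open>z\<close> satisfying the images of all relations defines a
  homomorphism.\<close>

lemma extend_rng_hom:
  assumes A: "subrng A" "rng_hom A \<psi>"
    and z: "\<And>r. r \<in> polys A \<Longrightarrow> poly r y = 0 \<Longrightarrow> poly (map_poly \<psi> r) z = 0"
  shows "\<exists>\<psi>'. rng_hom (adjoin A y) \<psi>' \<and> (\<forall>r\<in>polys A. \<psi>' (poly r y) = poly (map_poly \<psi> r) z)"
proof -
  note P = subrng_polys[OF A(1)]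
  define rep where "rep b = (SOME r. r \<in> polys A \<and> poly r y = b)" for b
  define \<psi>' where "\<psi>' b = poly (map_poly \<psi> (rep b)) z" for b
  have ev: "\<psi>' (poly r y) = poly (map_poly \<psi> r) z" if r: "r \<in> polys A" for r
  proof -
    have rep: "rep (poly r y) \<in> polys A \<and> poly (rep (poly r y)) y = poly r y"
      unfolding rep_def by (rule someI[of _ r]) (simp add: r)
    \<comment> \<open>Two representatives of one element differ by a relation, which is sent to
      0.\<close>
    define d where "d = rep (poly r y) - r"
    have d: "d \<in> polys A" "rep (poly r y) = r + d" "poly d y = 0"
      using rep r by (auto simp: d_def intro: subrng_diff[OF P])
    then show ?thesis
      using z[OF d(1,3)] unfolding \<psi>'_def d(2) by (simp add: map_poly_rng_hom(1)[OF A r d(1)])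
  qed
  moreover have "rng_hom (adjoin A y) \<psi>'"
    unfolding rng_hom_def adjoin_def
  proof safe
    fix p q assume pq: "p \<in> polys A" "q \<in> polys A"
    have "\<psi>' (poly (p + q) y) = \<psi>' (poly p y) + \<psi>' (poly q y)"
      using pq subrng_add[OF P] by (simp add: ev map_poly_rng_hom[OF A] del: poly_add) simp
    then show "\<psi>' (poly p y + poly q y) = \<psi>' (poly p y) + \<psi>' (poly q y)" by simp
    have "\<psi>' (poly (p * q) y) = \<psi>' (poly p y) * \<psi>' (poly q y)"
      using pq subrng_mult[OF P] by (simp add: ev map_poly_rng_hom[OF A] del: poly_mult) simp
    then show "\<psi>' (poly p y * poly q y) = \<psi>' (poly p y) * \<psi>' (poly q y)" by simp
  qed
  ultimately show ?thesis by blast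
qed

text \<open>If \<open>y\<close> is transcendental over \<open>A\<close> and
  \<open>H = poly q y\<close>, take for \<open>h\<close> the leading coefficient of
  \<open>q\<close>: the image of \<open>q\<close> is then a nonzero polynomial, and \<open>z\<close>
  only has to avoid its roots. If \<open>y\<close> is algebraic, \<open>z\<close> must be a root of
  the image of the minimal polynomial, and \<open>H\<close> stays nonzero because it divides an
  element of \<open>A\<close> with nonzero image.\<close>

lemma generic_extension:
  assumes A: "subrng A" and B: "no_zero_div (adjoin A y)" and H: "H \<in> adjoin A y" "H \<noteq> 0"
  shows "\<exists>h\<in>A. h \<noteq> 0 \<and> (\<forall>\<psi>. rng_hom A \<psi> \<longrightarrow> \<psi> h \<noteq> (0::complex) \<longrightarrow>
    (\<exists>\<psi>'. rng_hom (adjoin A y) \<psi>' \<and> (\<forall>a\<in>A. \<psi>' a = \<psi> a) \<and> \<psi>' H \<noteq> 0))"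
proof -
  note P = subrng_polys[OF A]
  have nzA: "no_zero_div A" using no_zero_div_subset[OF B adjoin_superset[OF A]] .
  obtain q where q: "q \<in> polys A" "H = poly q y" using H by (auto simp: adjoin_def)
  have ext: "\<exists>\<psi>'. rng_hom (adjoin A y) \<psi>' \<and> (\<forall>a\<in>A. \<psi>' a = \<psi> a) \<and>
      (\<forall>r\<in>polys A. \<psi>' (poly r y) = poly (map_poly \<psi> r) z)"
    if hom: "rng_hom A \<psi>"
      and z: "\<And>r. r \<in> polys A \<Longrightarrow> poly r y = 0 \<Longrightarrow> poly (map_poly \<psi> r) z = 0"
    for \<psi> and z :: complex
  proof -
    obtain \<psi>' where \<psi>': "rng_hom (adjoin A y) \<psi>'"
      "\<forall>r\<in>polys A. \<psi>' (poly r y) = poly (map_poly \<psi> r) z"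
      using extend_rng_hom[OF A hom z] by blast
    have "\<psi>' a = \<psi> a" if a: "a \<in> A" for a
      using \<psi>'(2)[rule_format, OF const_polys[OF A a]]
      by (simp add: map_poly_pCons rng_hom_0[OF A hom])
    then show ?thesis using \<psi>' by blast
  qed
  show ?thesis
  proof (cases "\<exists>p\<in>polys A. p \<noteq> 0 \<and> poly p y = 0")
    case False
    have q0: "q \<noteq> 0" using H q by auto
    show ?thesis
    proof (intro bexI[of _ "lead_coeff q"] conjI allI impI)
      fix \<psi> assume hom: "rng_hom A \<psi>" and h: "\<psi> (lead_coeff q) \<noteq> (0::complex)"
      have "Polynomial.coeff (map_poly \<psi> q) (degree q) \<noteq> 0"
        using h by (simp add: coeff_map_poly rng_hom_0[OF A hom])
      then have "map_poly \<psi> q \<noteq> 0" by (metis coeff_0)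
      then have "finite {z. poly (map_poly \<psi> q) z = 0}" by (rule poly_roots_finite)
      then obtain z where z: "poly (map_poly \<psi> q) z \<noteq> 0"
        using ex_new_if_finite[OF infinite_UNIV_char_0] by blast
      have "poly (map_poly \<psi> r) z = 0" if "r \<in> polys A" "poly r y = 0" for r
      proof -
        have "r = 0" using False that by blast
        then show ?thesis by simp
      qed
      then show "\<exists>\<psi>'. rng_hom (adjoin A y) \<psi>' \<and> (\<forall>a\<in>A. \<psi>' a = \<psi> a) \<and> \<psi>' H \<noteq> 0"
        using ext[OF hom] z q by metis
    qed (use q q0 in \<open>auto intro: polysD\<close>)
  next
    case True
    define p where "p = (ARG_MIN degree p. p \<in> polys A \<and> p \<noteq> 0 \<and> poly p y = 0)"
    have p: "p \<in> polys A" "p \<noteq> 0" "poly p y = 0"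
      and min: "\<And>q. q \<in> polys A \<Longrightarrow> q \<noteq> 0 \<Longrightarrow> poly q y = 0 \<Longrightarrow> degree p \<le> degree q"
    proof -
      obtain p' where "p' \<in> polys A \<and> p' \<noteq> 0 \<and> poly p' y = 0" using True by blast
      note * = arg_min_nat_lemma[of "\<lambda>p. p \<in> polys A \<and> p \<noteq> 0 \<and> poly p y = 0", OF this,
          of degree, folded p_def]
      show "p \<in> polys A" "p \<noteq> 0" "poly p y = 0" using * by auto
      show "degree p \<le> degree q" if "q \<in> polys A" "q \<noteq> 0" "poly q y = 0" for q
        using * that by auto
    qed
    have dp: "degree p > 0"
    proof (rule ccontr)
      assume "\<not> degree p > 0"
      then obtain c where "p = [:c:]" using degree_eq_zeroE[of p] by auto
      then show False using p by simp
    qed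
    let ?c = "lead_coeff p"
    have c: "?c \<in> A" "?c \<noteq> 0" using p by (auto simp: polysD)
    \<comment> \<open>Up to a power of \<open>?c\<close>, \<open>H\<close> is replaced by a value of
      a polynomial of degree below that of \<open>p\<close>, as
      \<open>minimal_polynomial_inverts\<close> demands.\<close>
    obtain k q' s where d: "q' \<in> polys A" "s \<in> polys A"
      "Polynomial.smult (?c ^ Suc k) q = q' * p + s" "degree s < degree p"
      using pseudo_division[OF A p(1) dp q(1)] by blast
    have ev: "?c ^ Suc k * H = poly s y"
      using arg_cong[OF d(3), of "\<lambda>p. poly p y"] p(3) q(2) by simp
    have ck: "?c ^ Suc k \<in> A" "?c ^ Suc k \<noteq> 0"
      using subrng_power[OF A c(1)] no_zero_div_power[OF A nzA c] by blast+
    then have "?c ^ Suc k \<in> adjoin A y" using adjoin_superset[OF A] by blast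
    then have "poly s y \<noteq> 0"
      using B H ck(2) unfolding ev[symmetric] no_zero_div_def by blast
    then have "s \<noteq> 0" by auto
    then obtain u h where u: "u \<in> polys A" "h \<in> A" "h \<noteq> 0" "poly u y * poly s y = h"
      using minimal_polynomial_inverts[OF A B p min d(2) _ d(4)] by blast
    have hH: "poly (Polynomial.smult (?c ^ Suc k) u * q) y = poly [:h:] y"
      using u(4) ev[symmetric] q(2) by (simp add: mult_ac)
    have uP: "Polynomial.smult (?c ^ Suc k) u \<in> polys A"
      using ck u(1) by (intro smult_polys[OF A])
    \<comment> \<open>The factor \<open>h\<close>, a multiple of \<open>H\<close>, keeps
      \<open>H\<close> nonzero; the factor \<open>?c\<close> keeps the degree of \<open>p\<close>,
      so that its image still has a root.\<close>
    show ?thesis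
    proof (intro bexI[of _ "h * ?c"] conjI allI impI)
      show "h * ?c \<noteq> 0" using nzA u(2,3) c unfolding no_zero_div_def by blast
      show "h * ?c \<in> A" using u c by (intro subrng_mult[OF A])
      fix \<psi> assume hom: "rng_hom A \<psi>" and h: "\<psi> (h * ?c) \<noteq> (0::complex)"
      note h0 = rng_hom_0[OF A hom]
      have h': "\<psi> h \<noteq> 0" "\<psi> ?c \<noteq> 0" using h hom u(2) c(1) by (auto simp: rng_hom_def)
      have "degree (map_poly \<psi> p) = degree p"
        using h'(2) by (intro antisym map_poly_degree_leq le_degree) (simp add: coeff_map_poly h0)
      then obtain z where z: "poly (map_poly \<psi> p) z = 0"
        using dp fundamental_theorem_of_algebra[of "map_poly \<psi> p"] by (auto simp: constant_degree)
      \<comment> \<open>Up to a power of \<open>?c\<close>, every relation \<open>r\<close> is a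
        multiple of \<open>p\<close>: the remainder vanishes at \<open>y\<close> and is too small in
        degree to be nonzero. Since the image of that power is nonzero, the root \<open>z\<close> is
        inherited by the image of \<open>r\<close>.\<close>
      have zero: "poly (map_poly \<psi> r) z = 0" if r: "r \<in> polys A" "poly r y = 0" for r
      proof -
        obtain k q' s where d: "q' \<in> polys A" "s \<in> polys A"
          "Polynomial.smult (?c ^ Suc k) r = q' * p + s" "degree s < degree p"
          using pseudo_division[OF A p(1) dp r(1)] by blast
        have "poly s y = 0"
          using arg_cong[OF d(3), of "\<lambda>p. poly p y"] p(3) r(2) by simp
        then have "s = 0" using min[OF d(2)] d(4) by (meson not_less)
        have cA: "?c ^ Suc k \<in> A" using c by (intro subrng_power A)
        have "map_poly \<psi> (Polynomial.smult (?c ^ Suc k) r) = map_poly \<psi> ([:?c ^ Suc k:] * r)" by simp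
        also have "\<dots> = map_poly \<psi> [:?c ^ Suc k:] * map_poly \<psi> r"
          using r by (intro map_poly_rng_hom[OF A hom] const_polys A cA)
        also have "\<dots> = Polynomial.smult (\<psi> (?c ^ Suc k)) (map_poly \<psi> r)"
          by (simp add: map_poly_pCons h0 del: power_Suc)
        finally have 1: "Polynomial.smult (\<psi> (?c ^ Suc k)) (map_poly \<psi> r) = map_poly \<psi> q' * map_poly \<psi> p"
          unfolding d(3) \<open>s = 0\<close> by (simp add: map_poly_rng_hom[OF A hom d(1) p(1)])
        have "\<psi> (?c ^ Suc j) = \<psi> ?c ^ Suc j" for j
        proof (induction j)
          case (Suc j)
          have "\<psi> (?c * ?c ^ Suc j) = \<psi> ?c * \<psi> (?c ^ Suc j)"
            using hom c(1) subrng_power[OF A c(1), of j] unfolding rng_hom_def by blast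
          then show ?case using Suc by simp
        qed simp
        then have "\<psi> (?c ^ Suc k) \<noteq> 0" using h'(2) by simp
        then show ?thesis
          using arg_cong[OF 1, of "\<lambda>p. poly p z"] z by (simp del: power_Suc)
      qed
      obtain \<psi>' where \<psi>': "rng_hom (adjoin A y) \<psi>'" "\<forall>a\<in>A. \<psi>' a = \<psi> a"
        "\<forall>r\<in>polys A. \<psi>' (poly r y) = poly (map_poly \<psi> r) z"
        using ext[OF hom zero] by blast
      have "\<psi>' (poly (Polynomial.smult (?c ^ Suc k) u) y * poly q y)
        = \<psi>' (poly (Polynomial.smult (?c ^ Suc k) u) y) * \<psi>' (poly q y)"
        using \<psi>'(1) adjoinI[OF uP, of y] adjoinI[OF q(1), of y] unfolding rng_hom_def by blast
      moreover have "\<psi>' (poly (Polynomial.smult (?c ^ Suc k) u) y * poly q y) = \<psi> h"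
        using hH \<psi>'(2) u(2) by (simp add: mult.assoc)
      ultimately have "\<psi>' H \<noteq> 0" using h'(1) q(2) by auto
      then show "\<exists>\<psi>'. rng_hom (adjoin A y) \<psi>' \<and> (\<forall>a\<in>A. \<psi>' a = \<psi> a) \<and> \<psi>' H \<noteq> 0"
        using \<psi>' by blast
    qed
  qed
qed

section \<open>Towers of generators\<close>

primrec adjoin_list :: "'r::comm_ring_1 set \<Rightarrow> 'r list \<Rightarrow> 'r set" where
  "adjoin_list A [] = A"
| "adjoin_list A (y # ys) = adjoin (adjoin_list A ys) y"

lemma subrng_adjoin_list: "subrng A \<Longrightarrow> subrng (adjoin_list A ys)"
  by (induction ys) (auto simp: subrng_adjoin)

lemma adjoin_list_superset: "subrng A \<Longrightarrow> A \<subseteq> adjoin_list A ys"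
proof (induction ys)
  case (Cons y ys)
  then show ?case using adjoin_superset[OF subrng_adjoin_list[OF Cons.prems], of ys y] by auto
qed simp

text \<open>Descent through the tower: the element \<open>h\<close> obtained at one stage is the
  element to be kept nonzero at the stage below.\<close>

lemma generic_extension_list:
  assumes A: "subrng A" and B: "no_zero_div (adjoin_list A ys)"
    and H: "H \<in> adjoin_list A ys" "H \<noteq> 0"
  shows "\<exists>h\<in>A. h \<noteq> 0 \<and> (\<forall>\<psi>. rng_hom A \<psi> \<longrightarrow> \<psi> h \<noteq> (0::complex) \<longrightarrow>
    (\<exists>\<psi>'. rng_hom (adjoin_list A ys) \<psi>' \<and> (\<forall>a\<in>A. \<psi>' a = \<psi> a) \<and> \<psi>' H \<noteq> 0))"
  using B H
proof (induction ys arbitrary: H)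
  case Nil
  then show ?case by auto
next
  case (Cons y ys)
  let ?A = "adjoin_list A ys"
  note A' = subrng_adjoin_list[OF A, of ys]
  obtain h where h: "h \<in> ?A" "h \<noteq> 0" "\<And>\<psi>. rng_hom ?A \<psi> \<Longrightarrow> \<psi> h \<noteq> (0::complex) \<Longrightarrow>
    (\<exists>\<psi>'. rng_hom (adjoin ?A y) \<psi>' \<and> (\<forall>a\<in>?A. \<psi>' a = \<psi> a) \<and> \<psi>' H \<noteq> 0)"
    using generic_extension[OF A', of y H] Cons.prems by auto
  have "no_zero_div ?A"
    using Cons.prems(1) adjoin_superset[OF A', of y] by (auto intro: no_zero_div_subset)
  from Cons.IH[OF this h(1,2)] obtain h' where h': "h' \<in> A" "h' \<noteq> 0"
    "\<And>\<psi>. rng_hom A \<psi> \<Longrightarrow> \<psi> h' \<noteq> (0::complex) \<Longrightarrow>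
      (\<exists>\<psi>'. rng_hom ?A \<psi>' \<and> (\<forall>a\<in>A. \<psi>' a = \<psi> a) \<and> \<psi>' h \<noteq> 0)" by blast
  have "\<exists>\<psi>'. rng_hom (adjoin ?A y) \<psi>' \<and> (\<forall>a\<in>A. \<psi>' a = \<psi> a) \<and> \<psi>' H \<noteq> 0"
    if \<psi>: "rng_hom A \<psi>" "\<psi> h' \<noteq> (0::complex)" for \<psi>
  proof -
    obtain \<psi>1 where 1: "rng_hom ?A \<psi>1" "\<forall>a\<in>A. \<psi>1 a = \<psi> a" "\<psi>1 h \<noteq> 0" using h'(3)[OF \<psi>] by blast
    obtain \<psi>2 where 2: "rng_hom (adjoin ?A y) \<psi>2" "\<forall>a\<in>?A. \<psi>2 a = \<psi>1 a" "\<psi>2 H \<noteq> 0"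
      using h(3)[OF 1(1,3)] by blast
    have "\<forall>a\<in>A. \<psi>2 a = \<psi> a" using 1(2) 2(2) adjoin_list_superset[OF A, of ys] by auto
    then show ?thesis using 2 by blast
  qed
  then show ?case using h'(1,2) by auto
qed

lemma adjoin_list_subset:
  "A \<subseteq> R \<Longrightarrow> subrng R \<Longrightarrow> set ys \<subseteq> R \<Longrightarrow> adjoin_list A ys \<subseteq> R"
  by (induction ys) (auto dest: adjoin_subset)

lemma adjoin_generator:
  assumes "subrng A" "e \<in> A" "e * y = y" shows "y \<in> adjoin A y"
  using adjoinI[OF monom_polys[OF assms(1,2), of 1], of y] assms(3) by (simp add: poly_monom mult.commute)

text \<open>\<open>e\<close> acts as a unit on the generators, so the monomial e X evaluates to the
  generator. In the chart below, \<open>e\<close> is the indicator function of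
  \<open>V\<close>.\<close>

lemma adjoin_list_generators:
  assumes "subrng A" "e \<in> A" "\<And>y. y \<in> set ys \<Longrightarrow> e * y = y"
  shows "set ys \<subseteq> adjoin_list A ys"
  using assms(3)
proof (induction ys)
  case (Cons y ys)
  note B = subrng_adjoin_list[OF assms(1), of ys]
  have "e \<in> adjoin_list A ys" using adjoin_list_superset[OF assms(1)] assms(2) by blast
  then have "y \<in> adjoin (adjoin_list A ys) y" using Cons.prems B by (intro adjoin_generator) auto
  then show ?case using Cons adjoin_superset[OF B, of y] by auto
qed simp

section \<open>Values omitted by a regular function on a variety\<close>

lemma const_forms: "Poly_Mapping.single 0 c \<in> forms N 0"
  by (simp add: forms_def monom_degree_def)

lemma poly_eval_const: "poly_eval x (Poly_Mapping.single 0 c) = c"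
  by (simp add: poly_eval_single monom_eval_def)

lemma topspace_zariski: "topspace (zariski N) = proj_space N"
proof -
  have "zero_locus N {Poly_Mapping.single 0 1} = {}"
    by (auto simp: zero_locus_def proj_space_def vanishes_at_line_through[OF const_forms]
        poly_eval_const simp del: single_one)
  then have "openin (zariski N) (proj_space N)"
    unfolding openin_zariski using const_forms[of 1 N]
    by (intro exI[of _ "{Poly_Mapping.single 0 1}"]) (auto simp del: single_one)
  moreover have "\<And>U. openin (zariski N) U \<Longrightarrow> U \<subseteq> proj_space N"
    by (auto simp: openin_zariski)
  ultimately show ?thesis by (metis openin_subset openin_topspace subset_antisym)
qed

lemma closedin_zariski:
  "closedin (zariski N) Z \<longleftrightarrow> (\<exists>S \<subseteq> (\<Union>d. forms N d). Z = zero_locus N S)"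
proof
  assume "closedin (zariski N) Z"
  then have Z: "Z \<subseteq> proj_space N" and "openin (zariski N) (proj_space N - Z)"
    by (auto simp: closedin_def topspace_zariski)
  then obtain S where S: "S \<subseteq> (\<Union>d. forms N d)" "proj_space N - Z = proj_space N - zero_locus N S"
    by (auto simp: openin_zariski)
  moreover have "zero_locus N S \<subseteq> proj_space N" by (auto simp: zero_locus_def)
  ultimately have "Z = zero_locus N S" using Z by blast
  then show "\<exists>S \<subseteq> (\<Union>d. forms N d). Z = zero_locus N S" using S by blast
next
  assume "\<exists>S \<subseteq> (\<Union>d. forms N d). Z = zero_locus N S"
  then show "closedin (zariski N) Z"
    by (auto simp: closedin_def topspace_zariski openin_zariski zero_locus_def)
qed

lemma var_forms: "i \<le> N \<Longrightarrow> Poly_Mapping.single (Poly_Mapping.single i 1) 1 \<in> forms N 1"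
  by (simp add: forms_def monom_degree_def)

lemma poly_eval_var: "poly_eval x (Poly_Mapping.single (Poly_Mapping.single i 1) 1) = x i"
  by (simp add: poly_eval_single monom_eval_def)

lemma poly_eval_diff: "poly_eval x (F - G) = poly_eval x F - poly_eval x G"
  using poly_eval_add[of x "F - G" G] by simp

lemma forms_diff: "F \<in> forms N d \<Longrightarrow> G \<in> forms N d \<Longrightarrow> F - G \<in> forms N d"
  using keys_diff[of F G] by (auto simp: forms_def)

lemma forms_power: "F \<in> forms N d \<Longrightarrow> F ^ n \<in> forms N (n * d)"
proof (induction n)
  case 0
  then show ?case using const_forms[of 1 N] by simp
next
  case (Suc n)
  then show ?case using forms_mult[of F N d "F ^ n" "n * d"] by simp
qed

lemma poly_eval_one: "poly_eval x 1 = 1"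
  using poly_eval_const[of x 1] by simp

lemma poly_eval_power: "poly_eval x (F ^ n) = poly_eval x F ^ n"
  by (induction n) (simp_all add: poly_eval_one poly_eval_mult)

lemma closedin_zero_locus: "F \<in> forms N d \<Longrightarrow> closedin (zariski N) (zero_locus N {F})"
  unfolding closedin_zariski by (intro exI[of _ "{F}"]) auto

lemma irreducible_inD:
  "irreducible_in T Z \<Longrightarrow> closedin T A \<Longrightarrow> closedin T B \<Longrightarrow> Z \<subseteq> A \<union> B \<Longrightarrow> Z \<subseteq> A \<or> Z \<subseteq> B"
  unfolding irreducible_in_def by iprover

lemma line_through_scale: "c \<noteq> 0 \<Longrightarrow> line_through (\<lambda>i. c * x i) = line_through x"
proof -
  assume c: "c \<noteq> 0"
  have "\<exists>b. (\<lambda>i. a * x i) = (\<lambda>i. b * (c * x i)) \<and> b \<noteq> 0" if "a \<noteq> 0" for a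
    using c that by (intro exI[of _ "a / c"]) auto
  moreover have "\<exists>b. (\<lambda>i. a * (c * x i)) = (\<lambda>i. b * x i) \<and> b \<noteq> 0" if "a \<noteq> 0" for a
    using c that by (intro exI[of _ "a * c"]) auto
  ultimately show ?thesis unfolding line_through_def by blast
qed

text \<open>Functions on \<open>V\<close> are represented by functions that are zero elsewhere, so that the regular
  ones form a subset without zero divisors of the ring of all functions. Its unit is the indicator
  function of \<open>V\<close>, which is why \<open>subrng\<close> does not require \<open>1\<close>.\<close>

locale affine_chart =
  fixes N :: nat and X :: "proj_point set" and k :: nat and H P Q :: cpoly and d e :: nat
    and V :: "(nat \<Rightarrow> complex) set"
  defines "V \<equiv> {x. x k = 1 \<and> (\<forall>i>N. x i = 0) \<and> line_through x \<in> X \<and> poly_eval x H \<noteq> 0}"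
  assumes X: "projective_variety N X" and k: "k \<le> N"
    and H: "H \<in> forms N e" and P: "P \<in> forms N d" and Q: "Q \<in> forms N d"
    and V_nonempty: "V \<noteq> {}" and Q_nonzero: "\<And>x. x \<in> V \<Longrightarrow> poly_eval x Q \<noteq> 0"
begin

section \<open>The regular functions on a chart form a domain\<close>

definition res :: "((nat \<Rightarrow> complex) \<Rightarrow> complex) \<Rightarrow> (nat \<Rightarrow> complex) \<Rightarrow> complex" where
  "res F = (\<lambda>x. if x \<in> V then F x else 0)"

text \<open>On \<open>V\<close> the coordinate \<open>x k\<close> is 1, so forms act as arbitrary
  polynomials and the degree of \<open>G\<close> is not tied to that of \<open>Q ^ n\<close>. The
  purpose is a domain large enough to contain \<open>f\<close> and the coordinates.\<close>

definition regular :: "((nat \<Rightarrow> complex) \<Rightarrow> complex) set" where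
  "regular = {F. (\<forall>x. x \<notin> V \<longrightarrow> F x = 0) \<and>
    (\<exists>n D. \<exists>G\<in>forms N D. \<forall>x\<in>V. F x * poly_eval x Q ^ n = poly_eval x G)}"

lemma res_regularI:
  assumes "G \<in> forms N D" "\<And>x. x \<in> V \<Longrightarrow> F x * poly_eval x Q ^ n = poly_eval x G"
  shows "res F \<in> regular"
proof -
  have "\<exists>n D. \<exists>G\<in>forms N D. \<forall>x\<in>V. res F x * poly_eval x Q ^ n = poly_eval x G"
    using assms by (intro exI[of _ n] exI[of _ D] bexI[of _ G]) (auto simp: res_def)
  then show ?thesis by (simp add: regular_def res_def)
qed

text \<open>A form of degree one that equals 1 on \<open>V\<close>: multiplication by its powers
  adjusts degrees without changing values there.\<close>

definition xk :: cpoly where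
  "xk = Poly_Mapping.single (Poly_Mapping.single k 1) 1"

lemma xk_forms: "xk \<in> forms N 1"
  unfolding xk_def by (rule var_forms[OF k])

lemma poly_eval_xk: "poly_eval x xk = x k"
  unfolding xk_def by (rule poly_eval_var)

lemma eval_xk: "x \<in> V \<Longrightarrow> poly_eval x xk = 1"
  by (simp add: poly_eval_xk V_def)

lemma regularE:
  assumes "F \<in> regular"
  obtains n D G where "G \<in> forms N D" "\<And>x. x \<in> V \<Longrightarrow> F x * poly_eval x Q ^ n = poly_eval x G"
    "F = res F"
proof -
  have "F = res F" using assms by (auto simp: regular_def res_def)
  moreover obtain n D G where "G \<in> forms N D" "\<forall>x\<in>V. F x * poly_eval x Q ^ n = poly_eval x G"
    using assms unfolding regular_def by blast
  ultimately show ?thesis using that by blast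
qed

lemma subrng_regular: "subrng regular"
  unfolding subrng_def
proof (intro conjI ballI)
  have "res (\<lambda>x. 0) \<in> regular"
    by (rule res_regularI[OF const_forms[of 0], of _ 0]) (simp add: poly_eval_const)
  moreover have "res (\<lambda>x. 0) = 0" by (auto simp: res_def fun_eq_iff)
  ultimately show "0 \<in> regular" by simp
  fix F1 F2 assume "F1 \<in> regular" "F2 \<in> regular"
  then obtain n1 D1 G1 n2 D2 G2
    where 1: "G1 \<in> forms N D1" "\<And>x. x \<in> V \<Longrightarrow> F1 x * poly_eval x Q ^ n1 = poly_eval x G1" "F1 = res F1"
      and 2: "G2 \<in> forms N D2" "\<And>x. x \<in> V \<Longrightarrow> F2 x * poly_eval x Q ^ n2 = poly_eval x G2" "F2 = res F2"
    by (metis regularE)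
  have xk: "xk ^ n \<in> forms N n" for n using forms_power[OF xk_forms, of n] by simp
  have "res (\<lambda>x. F1 x * F2 x) \<in> regular"
  proof (rule res_regularI)
    show "G1 * G2 \<in> forms N (D1 + D2)" using 1 2 by (intro forms_mult)
    show "F1 x * F2 x * poly_eval x Q ^ (n1 + n2) = poly_eval x (G1 * G2)" if "x \<in> V" for x
      unfolding poly_eval_mult 1(2)[OF that, symmetric] 2(2)[OF that, symmetric]
      by (simp add: power_add mult_ac)
  qed
  moreover have "res (\<lambda>x. F1 x * F2 x) = F1 * F2"
    by (subst 1(3), subst 2(3)) (auto simp: res_def fun_eq_iff)
  ultimately show "F1 * F2 \<in> regular" by simp
  \<comment> \<open>Common denominator \<open>Q ^ (n1 + n2)\<close>; the powers of \<open>xk\<close>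
    give both terms the same degree, so that their difference is again a form.\<close>
  define G where "G = G1 * Q ^ n2 * xk ^ (D2 + n1 * d) - G2 * Q ^ n1 * xk ^ (D1 + n2 * d)"
  have "res (\<lambda>x. F1 x - F2 x) \<in> regular"
  proof (rule res_regularI)
    have "G1 * Q ^ n2 * xk ^ (D2 + n1 * d) \<in> forms N (D1 + n2 * d + (D2 + n1 * d))"
      by (intro forms_mult 1(1) forms_power Q xk)
    moreover have "G2 * Q ^ n1 * xk ^ (D1 + n2 * d) \<in> forms N (D2 + n1 * d + (D1 + n2 * d))"
      by (intro forms_mult 2(1) forms_power Q xk)
    ultimately show "G \<in> forms N (D1 + n2 * d + (D2 + n1 * d))"
      unfolding G_def by (intro forms_diff) (simp_all add: add_ac)
    fix x assume x: "x \<in> V"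
    have "poly_eval x G = poly_eval x G1 * poly_eval x Q ^ n2 - poly_eval x G2 * poly_eval x Q ^ n1"
      unfolding G_def using eval_xk[OF x] by (simp add: poly_eval_diff poly_eval_mult poly_eval_power)
    then show "(F1 x - F2 x) * poly_eval x Q ^ (n1 + n2) = poly_eval x G"
      unfolding 1(2)[OF x, symmetric] 2(2)[OF x, symmetric] by (simp add: algebra_simps power_add)
  qed
  moreover have "res (\<lambda>x. F1 x - F2 x) = F1 - F2"
    by (subst 1(3), subst 2(3)) (auto simp: res_def fun_eq_iff)
  ultimately show "F1 - F2 \<in> regular" by simp
qed

text \<open>The factor \<open>H * xk\<close> vanishes at all points of \<open>X\<close> outside the
  chart, so the product vanishes on the whole of \<open>X\<close>, and irreducibility of
  \<open>X\<close> applies to the two zero loci.\<close>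

lemma forms_no_zero_div:
  assumes G1: "G1 \<in> forms N D1" and G2: "G2 \<in> forms N D2"
    and 0: "\<And>x. x \<in> V \<Longrightarrow> poly_eval x G1 * poly_eval x G2 = 0"
  shows "(\<forall>x\<in>V. poly_eval x G1 = 0) \<or> (\<forall>x\<in>V. poly_eval x G2 = 0)"
proof -
  let ?G = "G2 * (H * xk)"
  have G: "?G \<in> forms N (D2 + (e + 1))" by (intro forms_mult G2 H xk_forms)
  have cover: "X \<subseteq> zero_locus N {G1} \<union> zero_locus N {?G}"
  proof
    fix p assume p: "p \<in> X"
    then have pN: "p \<in> proj_space N"
      using X closedin_subset unfolding projective_variety_def by (force simp: topspace_zariski)
    then obtain x where x: "p = line_through x" "\<forall>i>N. x i = 0" by (auto simp: proj_space_def)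
    show "p \<in> zero_locus N {G1} \<union> zero_locus N {?G}"
    proof (cases "poly_eval x H = 0 \<or> x k = 0")
      case True
      then have "poly_eval x ?G = 0"
        by (auto simp: poly_eval_mult poly_eval_xk)
      then show ?thesis
        using pN x by (simp add: zero_locus_def vanishes_at_line_through[OF G])
    next
      case False
      \<comment> \<open>The representative of the same point with \<open>k\<close>-th coordinate 1,
        as membership in \<open>V\<close> requires.\<close>
      define y where "y = (\<lambda>i. (1 / x k) * x i)"
      have py: "p = line_through y" unfolding y_def x(1) using False by (intro line_through_scale[symmetric]) simp
      have "poly_eval y H \<noteq> 0" unfolding y_def using False by (subst poly_eval_scale[OF H]) simp
      then have "y \<in> V" using x(2) False p py by (simp add: V_def) (simp add: y_def)
      then have "poly_eval y G1 = 0 \<or> poly_eval y ?G = 0" using 0[of y] by (auto simp: poly_eval_mult)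
      then show ?thesis
        using pN unfolding py by (auto simp: zero_locus_def vanishes_at_line_through[OF G]
          vanishes_at_line_through[OF G1])
    qed
  qed
  have closed: "closedin (zariski N) (zero_locus N {G1})" "closedin (zariski N) (zero_locus N {?G})"
    by (rule closedin_zero_locus[OF G1], rule closedin_zero_locus[OF G])
  have "irreducible_in (zariski N) X" using X by (simp only: projective_variety_def)
  from irreducible_inD[OF this closed cover]
  show ?thesis
  proof
    assume *: "X \<subseteq> zero_locus N {G1}"
    have "poly_eval x G1 = 0" if "x \<in> V" for x
    proof -
      have "line_through x \<in> X" using that by (simp add: V_def)
      then have "vanishes_at G1 (line_through x)" using * by (auto simp: zero_locus_def)
      then show ?thesis by (simp add: vanishes_at_line_through[OF G1])
    qed
    then show ?thesis by blast
  next
    assume *: "X \<subseteq> zero_locus N {?G}"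
    have "poly_eval x G2 = 0" if "x \<in> V" for x
    proof -
      have "line_through x \<in> X" using that by (simp add: V_def)
      then have "vanishes_at ?G (line_through x)" using * by (auto simp: zero_locus_def)
      then have "poly_eval x ?G = 0" by (simp only: vanishes_at_line_through[OF G])
      then show ?thesis using eval_xk[OF that] that by (simp add: poly_eval_mult V_def)
    qed
    then show ?thesis by blast
  qed
qed

lemma no_zero_div_regular: "no_zero_div regular"
  unfolding no_zero_div_def
proof (intro ballI impI)
  fix F1 F2 assume "F1 \<in> regular" "F2 \<in> regular" and 0: "F1 * F2 = 0"
  then obtain n1 D1 G1 n2 D2 G2
    where 1: "G1 \<in> forms N D1" "\<And>x. x \<in> V \<Longrightarrow> F1 x * poly_eval x Q ^ n1 = poly_eval x G1" "F1 = res F1"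
      and 2: "G2 \<in> forms N D2" "\<And>x. x \<in> V \<Longrightarrow> F2 x * poly_eval x Q ^ n2 = poly_eval x G2" "F2 = res F2"
    by (metis regularE)
  have "F1 x * F2 x = 0" for x using 0 by (metis times_fun_apply zero_fun_apply)
  then have "poly_eval x G1 * poly_eval x G2 = 0" if "x \<in> V" for x
    unfolding 1(2)[OF that, symmetric] 2(2)[OF that, symmetric] by (metis mult_eq_0_iff)
  from forms_no_zero_div[OF 1(1) 2(1) this]
  show "F1 = 0 \<or> F2 = 0"
  proof
    assume "\<forall>x\<in>V. poly_eval x G1 = 0"
    then have "F1 x = 0" if "x \<in> V" for x using 1(2)[OF that] Q_nonzero[OF that] that by auto
    then have "F1 = 0" by (subst 1(3)) (auto simp: fun_eq_iff res_def)
    then show ?thesis ..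
  next
    assume "\<forall>x\<in>V. poly_eval x G2 = 0"
    then have "F2 x = 0" if "x \<in> V" for x using 2(2)[OF that] Q_nonzero[OF that] that by auto
    then have "F2 = 0" by (subst 2(3)) (auto simp: fun_eq_iff res_def)
    then show ?thesis ..
  qed
qed

section \<open>The ring generated by \<open>f\<close> and the coordinates\<close>

definition f :: "(nat \<Rightarrow> complex) \<Rightarrow> complex" where
  "f = res (\<lambda>x. poly_eval x P / poly_eval x Q)"

text \<open>Substitution of \<open>f\<close> for the variable; \<open>range emb\<close> is C[f], the
  base ring from which homomorphisms are extended.\<close>

definition emb :: "complex poly \<Rightarrow> (nat \<Rightarrow> complex) \<Rightarrow> complex" where
  "emb p = res (\<lambda>x. poly p (f x))"

definition coord :: "nat \<Rightarrow> (nat \<Rightarrow> complex) \<Rightarrow> complex" where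
  "coord i = res (\<lambda>x. x i)"

text \<open>C[f, x_0, ..., x_N] on \<open>V\<close>. The coordinates are adjoined to C[f] and not to
  C, so that the value of \<open>f\<close> can be prescribed first.\<close>

definition poly_ring :: "((nat \<Rightarrow> complex) \<Rightarrow> complex) set" where
  "poly_ring = adjoin_list (range emb) (map coord [0..<Suc N])"

lemma emb_simps:
  "emb 0 = 0" "emb (p - q) = emb p - emb q" "emb (p + q) = emb p + emb q" "emb (p * q) = emb p * emb q"
  by (auto simp: emb_def res_def fun_eq_iff)

lemma subrng_emb: "subrng (range emb)"
  unfolding subrng_def by (auto simp flip: emb_simps)

lemma f_regular: "f \<in> regular"
  unfolding f_def by (rule res_regularI[OF P, of _ 1]) (use Q_nonzero in auto)

lemma coord_regular: "i \<le> N \<Longrightarrow> coord i \<in> regular"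
  unfolding coord_def by (rule res_regularI[OF var_forms, of _ _ 0]) (simp_all add: poly_eval_var del: One_nat_def)

lemma emb_regular: "emb p \<in> regular"
proof (induction p)
  case 0
  show ?case unfolding emb_simps by (rule subrng_0[OF subrng_regular])
next
  case (pCons a p)
  have "emb (pCons a p) = res (\<lambda>x. a) + f * emb p"
    by (auto simp: emb_def res_def fun_eq_iff f_def)
  moreover have "res (\<lambda>x. a) \<in> regular"
    by (rule res_regularI[OF const_forms[of a], of _ 0]) (simp add: poly_eval_const)
  ultimately show ?case
    using pCons subrng_add[OF subrng_regular _ subrng_mult[OF subrng_regular f_regular]] by metis
qed

text \<open>A nonconstant \<open>f\<close> is transcendental over C: \<open>p\<close> splits into
  linear factors, none of the functions f - r is zero, and \<open>regular\<close> has no zero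
  divisors.\<close>

lemma emb_eq_0:
  assumes nonconst: "\<And>c. \<exists>x\<in>V. poly_eval x P \<noteq> c * poly_eval x Q" and "emb p = 0"
  shows "p = 0"
  using assms(2)
proof (induction "degree p" arbitrary: p rule: less_induct)
  case less
  show ?case
  proof (cases "degree p = 0")
    case True
    then obtain c where "p = [:c:]" by (rule degree_eq_zeroE)
    moreover obtain x where "x \<in> V" using V_nonempty by blast
    ultimately show ?thesis using fun_cong[OF less.prems, of x] by (simp add: emb_def res_def)
  next
    case False
    then obtain r where "poly p r = 0"
      using fundamental_theorem_of_algebra[of p] by (auto simp: constant_degree)
    then obtain q where q: "p = [:-r, 1:] * q" by (auto simp: poly_eq_0_iff_dvd dvd_def)
    have q0: "q \<noteq> 0" using False q by auto
    have "emb [:-r, 1:] * emb q = 0" using less.prems unfolding q emb_simps .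
    then have "emb [:-r, 1:] = 0 \<or> emb q = 0"
      using no_zero_div_regular emb_regular unfolding no_zero_div_def by blast
    moreover have "emb [:-r, 1:] \<noteq> 0"
    proof
      assume *: "emb [:-r, 1:] = 0"
      obtain x where x: "x \<in> V" "poly_eval x P \<noteq> r * poly_eval x Q" using nonconst by blast
      then show False using fun_cong[OF *, of x] Q_nonzero[OF x(1)]
        by (simp add: emb_def res_def f_def field_simps)
    qed
    moreover have "degree q < degree p" unfolding q using q0 by (subst degree_mult_eq) auto
    ultimately show ?thesis using less.hyps[of q] q0 by blast
  qed
qed

lemma subrng_poly_ring: "subrng poly_ring"
  unfolding poly_ring_def by (intro subrng_adjoin_list subrng_emb)

lemma emb_poly_ring: "emb p \<in> poly_ring"
  unfolding poly_ring_def using adjoin_list_superset[OF subrng_emb] by blast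

lemma coord_poly_ring: "i \<le> N \<Longrightarrow> coord i \<in> poly_ring"
proof -
  have "set (map coord [0..<Suc N]) \<subseteq> poly_ring"
    unfolding poly_ring_def
  proof (rule adjoin_list_generators[OF subrng_emb rangeI])
    show "emb 1 * y = y" if "y \<in> set (map coord [0..<Suc N])" for y
      using that by (auto simp: emb_def coord_def res_def fun_eq_iff simp del: upt_Suc)
  qed
  then show "i \<le> N \<Longrightarrow> coord i \<in> poly_ring" by (auto simp del: upt_Suc)
qed

lemma no_zero_div_poly_ring: "no_zero_div poly_ring"
proof (rule no_zero_div_subset[OF no_zero_div_regular])
  show "poly_ring \<subseteq> regular" unfolding poly_ring_def
    by (rule adjoin_list_subset) (auto simp: emb_regular subrng_regular coord_regular simp del: upt_Suc)
qed

text \<open>Membership and value are proved in one induction, since \<open>\<psi>\<close> is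
  multiplicative only on \<open>poly_ring\<close>. The assumption on \<open>emb\<close> says that
  \<open>\<psi>\<close> fixes constants.\<close>

lemma res_monom_poly_ring:
  assumes "finite S" "S \<subseteq> {..N}"
  shows "res (\<lambda>x. c * (\<Prod>i\<in>S. x i ^ g i)) \<in> poly_ring" (is "?in S")
    and "rng_hom poly_ring \<psi> \<Longrightarrow> (\<And>p. \<psi> (emb p) = poly p a) \<Longrightarrow>
      \<psi> (res (\<lambda>x. c * (\<Prod>i\<in>S. x i ^ g i))) = c * (\<Prod>i\<in>S. \<psi> (coord i) ^ g i)" (is "PROP ?hom S")
proof -
  have "?in S \<and> (rng_hom poly_ring \<psi> \<longrightarrow> (\<forall>p. \<psi> (emb p) = poly p a) \<longrightarrow>
      \<psi> (res (\<lambda>x. c * (\<Prod>i\<in>S. x i ^ g i))) = c * (\<Prod>i\<in>S. \<psi> (coord i) ^ g i))"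
    using assms
  proof (induction S rule: finite_induct)
    case empty
    have "res (\<lambda>x. c) = emb [:c:]" by (auto simp: res_def emb_def fun_eq_iff)
    then show ?case using emb_poly_ring[of "[:c:]"] by simp
  next
    case (insert j S)
    have j: "coord j \<in> poly_ring" using insert.prems coord_poly_ring by simp
    let ?h = "\<lambda>n. res (\<lambda>x. x j ^ n * (c * (\<Prod>i\<in>S. x i ^ g i)))"
    have Suc: "?h (Suc n) = coord j * ?h n" for n by (auto simp: res_def coord_def fun_eq_iff)
    have "?h n \<in> poly_ring \<and> (rng_hom poly_ring \<psi> \<longrightarrow> (\<forall>p. \<psi> (emb p) = poly p a) \<longrightarrow>
      \<psi> (?h n) = \<psi> (coord j) ^ n * (c * (\<Prod>i\<in>S. \<psi> (coord i) ^ g i)))" for n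
    proof (induction n)
      case 0
      then show ?case using insert by simp
    next
      case (Suc n)
      then have n: "?h n \<in> poly_ring" by blast
      have "\<psi> (coord j * ?h n) = \<psi> (coord j) * \<psi> (?h n)" if "rng_hom poly_ring \<psi>"
        using that j n unfolding rng_hom_def by blast
      then show ?case
        using Suc subrng_mult[OF subrng_poly_ring j n] unfolding \<open>?h (Suc n) = _\<close>
        by (simp del: times_fun_apply)
    qed
    from this[of "g j"] show ?case using insert.hyps by (simp add: mult_ac)
  qed
  then show "?in S" "PROP ?hom S" by blast+
qed

text \<open>A homomorphism that fixes constants is the evaluation at the point whose coordinates are
  the images of the coordinate functions.\<close>

lemma res_form_poly_ring:
  assumes F: "F \<in> forms N D"
  shows "res (\<lambda>x. poly_eval x F) \<in> poly_ring"
    and "rng_hom poly_ring \<psi> \<Longrightarrow> (\<And>p. \<psi> (emb p) = poly p a) \<Longrightarrow>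
      \<psi> (res (\<lambda>x. poly_eval x F)) = poly_eval (\<lambda>i. if i \<le> N then \<psi> (coord i) else 0) F"
proof -
  let ?h = "\<lambda>m. res (\<lambda>x. Poly_Mapping.lookup F m * monom_eval x m)"
  have eq: "res (\<lambda>x. poly_eval x F) = (\<Sum>m\<in>Poly_Mapping.keys F. ?h m)"
  proof
    fix x
    have "(\<Sum>m\<in>K. ?h m) x = (\<Sum>m\<in>K. ?h m x)" for K
      by (induction K rule: infinite_finite_induct) auto
    then show "res (\<lambda>x. poly_eval x F) x = (\<Sum>m\<in>Poly_Mapping.keys F. ?h m) x"
      by (simp add: res_def poly_eval_def)
  qed
  have keys: "Poly_Mapping.keys m \<subseteq> {..N}" if "m \<in> Poly_Mapping.keys F" for m
    using F that by (auto simp: forms_def)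
  have m: "?h m \<in> poly_ring" if "m \<in> Poly_Mapping.keys F" for m
    unfolding monom_eval_def using keys[OF that] by (intro res_monom_poly_ring) auto
  show "res (\<lambda>x. poly_eval x F) \<in> poly_ring"
    unfolding eq by (intro subrng_sum[OF subrng_poly_ring] m)
  assume hom: "rng_hom poly_ring \<psi>" "\<And>p. \<psi> (emb p) = poly p a"
  have "\<psi> (res (\<lambda>x. poly_eval x F)) = (\<Sum>m\<in>Poly_Mapping.keys F. \<psi> (?h m))"
    unfolding eq by (intro rng_hom_sum[OF subrng_poly_ring] hom m)
  also have "\<dots> = poly_eval (\<lambda>i. if i \<le> N then \<psi> (coord i) else 0) F"
    unfolding poly_eval_def
  proof (rule sum.cong[OF refl])
    fix m assume "m \<in> Poly_Mapping.keys F"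
    note K = keys[OF this]
    have "\<psi> (?h m) = Poly_Mapping.lookup F m * (\<Prod>i\<in>Poly_Mapping.keys m. \<psi> (coord i) ^ Poly_Mapping.lookup m i)"
      unfolding monom_eval_def by (rule res_monom_poly_ring(2)[OF _ K hom]) simp
    also have "(\<Prod>i\<in>Poly_Mapping.keys m. \<psi> (coord i) ^ Poly_Mapping.lookup m i)
      = monom_eval (\<lambda>i. if i \<le> N then \<psi> (coord i) else 0) m"
      unfolding monom_eval_def using K by (intro prod.cong) auto
    finally show "\<psi> (?h m) = Poly_Mapping.lookup F m * monom_eval (\<lambda>i. if i \<le> N then \<psi> (coord i) else 0) m" .
  qed
  finally show "\<psi> (res (\<lambda>x. poly_eval x F)) = poly_eval (\<lambda>i. if i \<le> N then \<psi> (coord i) else 0) F" .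
qed

text \<open>Generic extension from C[f] to \<open>poly_ring\<close> yields an exceptional element
  \<open>emb p\<close>; every value that is not a root of \<open>p\<close> is attained.\<close>

theorem finite_missing_values:
  assumes nonconst: "\<And>c. \<exists>x\<in>V. poly_eval x P \<noteq> c * poly_eval x Q"
  shows "finite {a. \<forall>x\<in>V. poly_eval x P \<noteq> a * poly_eval x Q}"
proof -
  define E where "E F = res (\<lambda>x. poly_eval x F)" for F
  note in_ring = res_form_poly_ring(1)[folded E_def]
  have inj: "inj emb"
  proof (rule injI)
    fix p q assume "emb p = emb q"
    then have "emb (p - q) = 0" by (simp add: emb_simps)
    then show "p = q" using emb_eq_0[OF nonconst] by fastforce
  qed
  obtain x0 where x0: "x0 \<in> V" using V_nonempty by blast
  have "E H x0 \<noteq> 0" using x0 by (simp add: E_def res_def) (simp add: V_def)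
  then have "E H \<noteq> 0" by auto
  from generic_extension_list[OF subrng_emb no_zero_div_poly_ring[unfolded poly_ring_def]
      in_ring[OF H, unfolded poly_ring_def] this, folded poly_ring_def]
  obtain h where h: "h \<in> range emb" "h \<noteq> 0"
    "\<And>\<psi>. rng_hom (range emb) \<psi> \<Longrightarrow> \<psi> h \<noteq> (0::complex) \<Longrightarrow>
      \<exists>\<psi>'. rng_hom poly_ring \<psi>' \<and> (\<forall>a\<in>range emb. \<psi>' a = \<psi> a) \<and> \<psi>' (E H) \<noteq> 0" by blast
  obtain p where p: "h = emb p" using h by blast
  then have "p \<noteq> 0" using h emb_simps(1) by auto
  have "\<exists>x\<in>V. poly_eval x P = a * poly_eval x Q" if a: "poly p a \<noteq> 0" for a
  proof -
    \<comment> \<open>Evaluation of C[f] at f = a, well defined because \<open>emb\<close> is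
      injective.\<close>
    define \<psi> where "\<psi> F = poly (inv_into UNIV emb F) a" for F
    have \<psi>_emb: "\<psi> (emb q) = poly q a" for q by (simp add: \<psi>_def inv_f_f[OF inj])
    have "rng_hom (range emb) \<psi>"
      unfolding rng_hom_def by (auto simp: \<psi>_emb simp flip: emb_simps)
    then obtain \<psi>' where \<psi>': "rng_hom poly_ring \<psi>'" "\<forall>a\<in>range emb. \<psi>' a = \<psi> a" "\<psi>' (E H) \<noteq> 0"
      using h(3)[of \<psi>] a by (auto simp: p \<psi>_emb)
    then have emb': "\<psi>' (emb q) = poly q a" for q by (simp add: \<psi>_emb)
    \<comment> \<open>The point sought: its coordinates are the images of the coordinate functions.
      It remains to place it in \<open>V\<close> and to check its value under
      \<open>f\<close>.\<close>
    define z where "z = (\<lambda>i. if i \<le> N then \<psi>' (coord i) else 0)"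
    have ev: "\<psi>' (E F) = poly_eval z F" if "F \<in> forms N D" for F D
      unfolding E_def z_def by (rule res_form_poly_ring(2)[OF that \<psi>'(1) emb'])
    have "coord k = emb 1" by (auto simp: coord_def emb_def res_def fun_eq_iff V_def)
    then have zk: "z k = 1" using k emb'[of 1] by (simp add: z_def)
    have zN: "\<forall>i>N. z i = 0" by (simp add: z_def)
    have zH: "poly_eval z H \<noteq> 0" using \<psi>'(3) ev[OF H] by simp
    obtain S where S: "S \<subseteq> (\<Union>d. forms N d)" "X = zero_locus N S"
      using X by (auto simp: projective_variety_def closedin_zariski)
    \<comment> \<open>Equations of \<open>X\<close> are zero as functions on \<open>V\<close>, so
      the homomorphism sends them to 0.\<close>
    have "vanishes_at F (line_through z)" if F: "F \<in> S" for F
    proof -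
      obtain D where D: "F \<in> forms N D" using S F by blast
      have "poly_eval x F = 0" if "x \<in> V" for x
      proof -
        have "line_through x \<in> X" using that by (simp add: V_def)
        then have "vanishes_at F (line_through x)" using S F by (auto simp: zero_locus_def)
        then show ?thesis by (simp add: vanishes_at_line_through[OF D])
      qed
      then have "E F = emb 0" by (auto simp: E_def res_def emb_def fun_eq_iff)
      then have "poly_eval z F = 0" using ev[OF D] emb'[of 0] by simp
      then show ?thesis by (simp add: vanishes_at_line_through[OF D])
    qed
    moreover have "line_through z \<in> proj_space N"
      using zk zN unfolding proj_space_def by (auto intro!: exI[of _ z] exI[of _ k])
    ultimately have "z \<in> V" using S(2) zk zN zH by (simp add: V_def zero_locus_def)
    moreover have "poly_eval z P = a * poly_eval z Q"
    proof -
      \<comment> \<open>That is, P = f Q on \<open>V\<close>, and \<open>f\<close> is sent to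
        \<open>a\<close>.\<close>
      have "E P = emb [:0, 1:] * E Q"
        using Q_nonzero by (auto simp: E_def emb_def res_def f_def fun_eq_iff)
      then have "\<psi>' (E P) = a * \<psi>' (E Q)"
        using \<psi>'(1) emb_poly_ring[of "[:0, 1:]"] in_ring[OF Q] emb'[of "[:0, 1:]"]
        by (simp add: rng_hom_def)
      then show ?thesis by (simp add: ev[OF P] ev[OF Q])
    qed
    ultimately show ?thesis by blast
  qed
  then have "{a. \<forall>x\<in>V. poly_eval x P \<noteq> a * poly_eval x Q} \<subseteq> {a. poly p a = 0}" by blast
  then show ?thesis using poly_roots_finite[OF \<open>p \<noteq> 0\<close>] finite_subset by blast
qed

end

section \<open>Pairs of sections of a line bundle\<close>

text \<open>Complements of single hypersurfaces form a basis of the topology: outside the zero locus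
  of \<open>S\<close>, some one member of \<open>S\<close> does not vanish.\<close>

lemma openin_variety_nbhd:
  assumes "openin (subtopology (zariski N) X) W" "p \<in> W"
  shows "\<exists>e. \<exists>H\<in>forms N e. \<not> vanishes_at H p \<and> (\<forall>q\<in>X. \<not> vanishes_at H q \<longrightarrow> q \<in> proj_space N \<longrightarrow> q \<in> W)"
proof -
  obtain T where T: "openin (zariski N) T" "W = T \<inter> X"
    using assms(1) by (auto simp: openin_subtopology)
  then obtain S where S: "S \<subseteq> (\<Union>d. forms N d)" "T = proj_space N - zero_locus N S"
    by (auto simp: openin_zariski)
  then obtain H where "H \<in> S" "\<not> vanishes_at H p" using assms(2) T(2) by (auto simp: zero_locus_def)
  then show ?thesis using S T(2) by (force simp: zero_locus_def)
qed

lemma variety_subset: "projective_variety N X \<Longrightarrow> X \<subseteq> proj_space N"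
  unfolding projective_variety_def by (metis closedin_subset topspace_zariski)

lemma in_line_through: "x \<in> line_through x"
  by (auto simp: line_through_def intro!: exI[of _ 1])

lemma regular_on_local:
  assumes X: "X \<subseteq> proj_space N" and f: "regular_on N X U f" and p: "line_through y \<in> U"
  shows "\<exists>e d. \<exists>H\<in>forms N e. \<exists>F\<in>forms N d. \<exists>G\<in>forms N d. poly_eval y H \<noteq> 0 \<and>
    (\<forall>x. line_through x \<in> X \<longrightarrow> poly_eval x H \<noteq> 0 \<longrightarrow> line_through x \<in> U \<and>
      poly_eval x G \<noteq> 0 \<and> f (line_through x) = poly_eval x F / poly_eval x G)"
proof -
  obtain W d F G where W: "F \<in> forms N d" "G \<in> forms N d" "openin (subtopology (zariski N) X) W"
    "line_through y \<in> W" "W \<subseteq> U"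
    "\<And>q x. q \<in> W \<Longrightarrow> x \<in> q \<Longrightarrow> poly_eval x G \<noteq> 0 \<and> f q = poly_eval x F / poly_eval x G"
    using f p unfolding regular_on_def by metis
  obtain e H where H: "H \<in> forms N e" "\<not> vanishes_at H (line_through y)"
    "\<And>q. q \<in> X \<Longrightarrow> \<not> vanishes_at H q \<Longrightarrow> q \<in> W"
    using openin_variety_nbhd[OF W(3,4)] X by blast
  note v = vanishes_at_line_through[OF H(1)]
  have "line_through x \<in> U \<and> poly_eval x G \<noteq> 0 \<and> f (line_through x) = poly_eval x F / poly_eval x G"
    if "line_through x \<in> X" "poly_eval x H \<noteq> 0" for x
  proof -
    have "line_through x \<in> W" using H(3) that v by blast
    then show ?thesis using W(5,6) in_line_through by blast
  qed
  moreover have "poly_eval y H \<noteq> 0" using H(2) v by blast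
  ultimately show ?thesis using W(1,2) H(1) by blast
qed

text \<open>Two nonempty open subsets of an irreducible space meet; otherwise their complements
  would cover \<open>X\<close>.\<close>

lemma irreducible_nonvanishing:
  assumes X: "projective_variety N X" and F: "F \<in> forms N d" and G: "G \<in> forms N e"
    and x: "line_through x \<in> X" "poly_eval x F \<noteq> 0" and y: "line_through y \<in> X" "poly_eval y G \<noteq> 0"
  shows "\<exists>z. line_through z \<in> X \<and> (\<forall>i>N. z i = 0) \<and> poly_eval z F \<noteq> 0 \<and> poly_eval z G \<noteq> 0"
proof (rule ccontr)
  assume none: "\<not> ?thesis"
  have cover: "X \<subseteq> zero_locus N {F} \<union> zero_locus N {G}"
  proof
    fix p assume p: "p \<in> X"
    then have pN: "p \<in> proj_space N" using variety_subset[OF X] by blast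
    then obtain z where z: "p = line_through z" "\<forall>i>N. z i = 0" by (auto simp: proj_space_def)
    then show "p \<in> zero_locus N {F} \<union> zero_locus N {G}"
      using none p pN
      by (auto simp: zero_locus_def vanishes_at_line_through[OF F] vanishes_at_line_through[OF G])
  qed
  have "irreducible_in (zariski N) X" using X by (simp only: projective_variety_def)
  from irreducible_inD[OF this closedin_zero_locus[OF F] closedin_zero_locus[OF G] cover]
  show False
    using x y by (auto simp: zero_locus_def vanishes_at_line_through[OF F] vanishes_at_line_through[OF G])
qed

lemma global_sectionsD:
  assumes "s \<in> global_sections N X L"
  shows "s j p \<noteq> 0 \<Longrightarrow> j \<in> cover_index L \<and> p \<in> cover_set L j"
    and "j \<in> cover_index L \<Longrightarrow> regular_on N X (cover_set L j) (s j)"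
    and "i \<in> cover_index L \<Longrightarrow> j \<in> cover_index L \<Longrightarrow> p \<in> cover_set L i \<Longrightarrow> p \<in> cover_set L j \<Longrightarrow>
      s i p = trans_fun L i j p * s j p"
  using assms unfolding global_sections_def by blast+

text \<open>With a common denominator \<open>R\<close> the quotient of the two sections becomes
  \<open>P / Q\<close>, a quotient of forms of equal degree.\<close>

lemma quotient_of_sections_local:
  assumes X: "projective_variety N X" and L: "line_bundle N X L"
    and S: "S \<in> global_sections N X L" and U: "U \<in> global_sections N X L"
    and j: "j \<in> cover_index L" and y: "line_through y \<in> cover_set L j"
  shows "\<exists>e d. \<exists>H\<in>forms N e. \<exists>P\<in>forms N d. \<exists>Q\<in>forms N d. \<exists>R\<in>forms N d. poly_eval y H \<noteq> 0 \<and>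
    (\<forall>x. line_through x \<in> X \<longrightarrow> poly_eval x H \<noteq> 0 \<longrightarrow> line_through x \<in> cover_set L j \<and>
      poly_eval x R \<noteq> 0 \<and> U j (line_through x) = poly_eval x P / poly_eval x R \<and>
      S j (line_through x) = poly_eval x Q / poly_eval x R)"
proof -
  note XN = variety_subset[OF X]
  obtain e1 d1 H1 F1 G1 where 1: "H1 \<in> forms N e1" "F1 \<in> forms N d1" "G1 \<in> forms N d1"
    "poly_eval y H1 \<noteq> 0"
    "\<And>x. line_through x \<in> X \<Longrightarrow> poly_eval x H1 \<noteq> 0 \<Longrightarrow> line_through x \<in> cover_set L j \<and>
      poly_eval x G1 \<noteq> 0 \<and> S j (line_through x) = poly_eval x F1 / poly_eval x G1"
    using regular_on_local[OF XN global_sectionsD(2)[OF S j] y] by blast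
  obtain e2 d2 H2 F2 G2 where 2: "H2 \<in> forms N e2" "F2 \<in> forms N d2" "G2 \<in> forms N d2"
    "poly_eval y H2 \<noteq> 0"
    "\<And>x. line_through x \<in> X \<Longrightarrow> poly_eval x H2 \<noteq> 0 \<Longrightarrow> line_through x \<in> cover_set L j \<and>
      poly_eval x G2 \<noteq> 0 \<and> U j (line_through x) = poly_eval x F2 / poly_eval x G2"
    using regular_on_local[OF XN global_sectionsD(2)[OF U j] y] by blast
  have "H1 * H2 \<in> forms N (e1 + e2)" by (intro forms_mult 1 2)
  moreover have "F2 * G1 \<in> forms N (d1 + d2)" using forms_mult[OF 2(2) 1(3)] by (simp add: add.commute)
  moreover have "F1 * G2 \<in> forms N (d1 + d2)" "G1 * G2 \<in> forms N (d1 + d2)"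
    by (intro forms_mult 1 2)+
  moreover have "poly_eval y (H1 * H2) \<noteq> 0" using 1 2 by (simp add: poly_eval_mult)
  moreover have "line_through x \<in> cover_set L j \<and> poly_eval x (G1 * G2) \<noteq> 0 \<and>
      U j (line_through x) = poly_eval x (F2 * G1) / poly_eval x (G1 * G2) \<and>
      S j (line_through x) = poly_eval x (F1 * G2) / poly_eval x (G1 * G2)"
    if "line_through x \<in> X" "poly_eval x (H1 * H2) \<noteq> 0" for x
    using 1(5)[of x] 2(5)[of x] that by (auto simp: poly_eval_mult)
  ultimately show ?thesis by blast
qed

lemma line_bundle_cover_subset:
  "line_bundle N X L \<Longrightarrow> j \<in> cover_index L \<Longrightarrow> p \<in> cover_set L j \<Longrightarrow> p \<in> X"
  unfolding line_bundle_def by blast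

text \<open>The identity principle: the set where proportionality fails in chart \<open>j\<close>
  contains a nonempty open set as soon as it is nonempty, and this set meets the one where
  \<open>H\<close> does not vanish. There the transition function carries the relation from chart
  \<open>i\<close> to chart \<open>j\<close>.\<close>

lemma sections_proportional_everywhere:
  assumes X: "projective_variety N X" and L: "line_bundle N X L"
    and S: "S \<in> global_sections N X L" and U: "U \<in> global_sections N X L"
    and H: "H \<in> forms N e" and x0: "line_through x0 \<in> X" "poly_eval x0 H \<noteq> 0"
    and i: "i \<in> cover_index L"
    and eq: "\<And>x. line_through x \<in> X \<Longrightarrow> (\<forall>i>N. x i = 0) \<Longrightarrow> poly_eval x H \<noteq> 0 \<Longrightarrow>
      line_through x \<in> cover_set L i \<and> U i (line_through x) = c * S i (line_through x)"
  shows "U j p = c * S j p"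
proof (rule ccontr)
  assume neq: "U j p \<noteq> c * S j p"
  then have "U j p \<noteq> 0 \<or> S j p \<noteq> 0" by auto
  then have j: "j \<in> cover_index L" and p: "p \<in> cover_set L j"
    using global_sectionsD(1)[OF S] global_sectionsD(1)[OF U] by blast+
  have pX: "p \<in> X" using line_bundle_cover_subset[OF L j p] .
  then have "p \<in> proj_space N" using variety_subset[OF X] by blast
  then obtain y where y: "p = line_through y" by (auto simp: proj_space_def)
  obtain e' d H' P Q R where l: "H' \<in> forms N e'" "P \<in> forms N d" "Q \<in> forms N d" "R \<in> forms N d"
    "poly_eval y H' \<noteq> 0"
    "\<And>x. line_through x \<in> X \<Longrightarrow> poly_eval x H' \<noteq> 0 \<Longrightarrow> line_through x \<in> cover_set L j \<and>
      poly_eval x R \<noteq> 0 \<and> U j (line_through x) = poly_eval x P / poly_eval x R \<and>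
      S j (line_through x) = poly_eval x Q / poly_eval x R"
    using quotient_of_sections_local[OF X L S U j p[unfolded y]] by blast
  \<comment> \<open>The numerator of \<open>U j - c * S j\<close> near the point
    \<open>p\<close>.\<close>
  let ?D = "P - Poly_Mapping.single 0 c * Q"
  have cQ: "Poly_Mapping.single 0 c * Q \<in> forms N d" using forms_mult[OF const_forms l(3)] by simp
  have D: "H' * ?D \<in> forms N (e' + d)" by (intro forms_mult l forms_diff cQ)
  have ev: "poly_eval x (H' * ?D) = poly_eval x H' * (poly_eval x P - c * poly_eval x Q)" for x
    by (simp add: poly_eval_mult poly_eval_diff poly_eval_const)
  have "poly_eval y (H' * ?D) \<noteq> 0"
    using neq l(5) l(6)[of y] pX unfolding y ev by auto
  then obtain z where z: "line_through z \<in> X" "\<forall>i>N. z i = 0" "poly_eval z H \<noteq> 0"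
    "poly_eval z (H' * ?D) \<noteq> 0"
    using irreducible_nonvanishing[OF X H D x0] pX unfolding y by blast
  let ?q = "line_through z"
  have 1: "?q \<in> cover_set L i" "U i ?q = c * S i ?q" using eq[OF z(1-3)] by auto
  have 2: "?q \<in> cover_set L j" "poly_eval z R \<noteq> 0" "U j ?q = poly_eval z P / poly_eval z R"
    "S j ?q = poly_eval z Q / poly_eval z R" "poly_eval z P \<noteq> c * poly_eval z Q"
    using l(6)[OF z(1)] z(4) unfolding ev by auto
  have "U j ?q = c * S j ?q"
    using 1(2) global_sectionsD(3)[OF U j i 2(1) 1(1)] global_sectionsD(3)[OF S j i 2(1) 1(1)] by simp
  then show False using 2 by (simp add: field_simps)
qed

text \<open>The assumption on \<open>M\<close> says that \<open>U / S\<close> omits the values in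
  \<open>M\<close> wherever \<open>S\<close> is nonzero.\<close>

theorem sections_proportional:
  assumes X: "projective_variety N X" and L: "line_bundle N X L"
    and S: "S \<in> global_sections N X L" and U: "U \<in> global_sections N X L"
    and M: "infinite M" "\<And>a j p. a \<in> M \<Longrightarrow> U j p = a * S j p \<Longrightarrow> S j p = 0"
    and S0: "S i p0 \<noteq> 0"
  shows "\<exists>c. \<forall>j p. U j p = c * S j p"
proof -
  have i: "i \<in> cover_index L" and p0: "p0 \<in> cover_set L i" using global_sectionsD(1)[OF S S0] by auto
  have p0X: "p0 \<in> X" using line_bundle_cover_subset[OF L i p0] .
  then have "p0 \<in> proj_space N" using variety_subset[OF X] by blast
  then obtain y k where y: "p0 = line_through y" "y k \<noteq> 0" "\<forall>i>N. y i = 0" by (auto simp: proj_space_def)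
  have k: "k \<le> N" using y(2,3) by (meson not_less)
  define x0 where "x0 = (\<lambda>i. 1 / y k * y i)"
  have x0: "p0 = line_through x0" "x0 k = 1" "\<forall>i>N. x0 i = 0"
    using y line_through_scale[of "1 / y k" y] by (auto simp: x0_def)
  obtain e d H P Q R where l: "H \<in> forms N e" "P \<in> forms N d" "Q \<in> forms N d" "R \<in> forms N d"
    "poly_eval x0 H \<noteq> 0"
    "\<And>x. line_through x \<in> X \<Longrightarrow> poly_eval x H \<noteq> 0 \<Longrightarrow> line_through x \<in> cover_set L i \<and>
      poly_eval x R \<noteq> 0 \<and> U i (line_through x) = poly_eval x P / poly_eval x R \<and>
      S i (line_through x) = poly_eval x Q / poly_eval x R"
    using quotient_of_sections_local[OF X L S U i p0[unfolded x0(1)]] by blast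
  \<comment> \<open>The factor \<open>Q\<close> removes the zeros of \<open>S\<close>, so that
    \<open>U / S = P / Q\<close> is defined on all of \<open>V\<close>.\<close>
  define V where "V = {x. x k = 1 \<and> (\<forall>i>N. x i = 0) \<and> line_through x \<in> X \<and> poly_eval x (H * Q) \<noteq> 0}"
  have HQ: "H * Q \<in> forms N (e + d)" by (intro forms_mult l)
  have VD: "line_through x \<in> X" "poly_eval x H \<noteq> 0" "poly_eval x Q \<noteq> 0" if "x \<in> V" for x
    using that by (auto simp: V_def poly_eval_mult)
  have "poly_eval x0 Q \<noteq> 0" using S0 l(5) l(6)[of x0] p0X unfolding x0(1) by auto
  then have x0V: "x0 \<in> V" using x0 p0X l(5) by (simp add: V_def poly_eval_mult)
  have "affine_chart N X k (H * Q) P Q d (e + d)"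
    using X k HQ l(2,3) x0V VD(3) unfolding affine_chart_def V_def by blast
  note fin = affine_chart.finite_missing_values[OF this, folded V_def]
  have "\<exists>c. \<forall>x\<in>V. poly_eval x P = c * poly_eval x Q"
  proof (rule ccontr)
    assume "\<not> ?thesis"
    then have "finite {a. \<forall>x\<in>V. poly_eval x P \<noteq> a * poly_eval x Q}" by (intro fin) auto
    moreover have "M \<subseteq> {a. \<forall>x\<in>V. poly_eval x P \<noteq> a * poly_eval x Q}"
    proof safe
      fix a x assume a: "a \<in> M" and x: "x \<in> V" and eq: "poly_eval x P = a * poly_eval x Q"
      have "U i (line_through x) = a * S i (line_through x)" "S i (line_through x) \<noteq> 0"
        using l(6)[OF VD(1,2)[OF x]] VD(3)[OF x] eq by auto
      then show False using M(2)[OF a] by blast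
    qed
    ultimately show False using M(1) finite_subset by blast
  qed
  then obtain c where c: "\<And>x. x \<in> V \<Longrightarrow> poly_eval x P = c * poly_eval x Q" by blast
  define xk :: cpoly where "xk = Poly_Mapping.single (Poly_Mapping.single k 1) 1"
  have xk: "poly_eval x xk = x k" for x unfolding xk_def by (rule poly_eval_var)
  \<comment> \<open>The factor \<open>xk\<close> ensures that the point can be rescaled into
    \<open>V\<close>.\<close>
  have HH: "H * Q * xk \<in> forms N (e + d + 1)" unfolding xk_def by (intro forms_mult HQ l var_forms k)
  have "line_through x \<in> cover_set L i \<and> U i (line_through x) = c * S i (line_through x)"
    if x: "line_through x \<in> X" "\<forall>i>N. x i = 0" "poly_eval x (H * Q * xk) \<noteq> 0" for x
  proof -
    define w where "w = (\<lambda>i. 1 / x k * x i)"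
    have nz: "poly_eval x (H * Q) \<noteq> 0" "x k \<noteq> 0" using x(3) by (auto simp: poly_eval_mult xk)
    then have lw: "line_through w = line_through x" unfolding w_def by (intro line_through_scale) simp
    have "poly_eval w (H * Q) \<noteq> 0" unfolding w_def poly_eval_scale[OF HQ] using nz by simp
    then have w: "w \<in> V" using x lw nz by (auto simp: V_def) (auto simp: w_def)
    show ?thesis using l(6)[OF VD(1,2)[OF w]] c[OF w] unfolding lw by auto
  qed
  from sections_proportional_everywhere[OF X L S U HH _ _ i this] show ?thesis
    using x0V p0X x0 by (auto simp: poly_eval_mult xk V_def)
qed

section \<open>The algebra of an infinite divisor on the projective line\<close>

text \<open>\<open>rfun poly\<close> is C(x)[T], where T records the degree: a section of floor(n D)
  is a rational function times T^n. As a subring of C(x)[T], the algebra is a domain at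
  once.\<close>

type_synonym rfun = "complex poly fract"

definition scale :: "complex \<Rightarrow> rfun poly \<Rightarrow> rfun poly" where
  "scale c q = Polynomial.smult (to_fract [:c:]) q"

text \<open>Replacing the carrier, as \<open>cdim\<close> does, gives again a module of this form,
  so one lemma serves all subspaces.\<close>

definition rfun_module :: "rfun poly set \<Rightarrow> (complex, rfun poly) module" where
  "rfun_module W = \<lparr>carrier = W, monoid.mult = (*), one = 1, zero = 0, add = (+), module.smult = scale\<rparr>"

lemma rfun_module_simps [simp]:
  "carrier (rfun_module W) = W" "monoid.mult (rfun_module W) = (*)"
  "one (rfun_module W) = 1" "zero (rfun_module W) = 0" "add (rfun_module W) = (+)"
  "module.smult (rfun_module W) = scale" "(rfun_module W)\<lparr>carrier := W'\<rparr> = rfun_module W'"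
  by (simp_all add: rfun_module_def)

definition lin_closed :: "rfun poly set \<Rightarrow> bool" where
  "lin_closed W \<longleftrightarrow> 0 \<in> W \<and> (\<forall>a\<in>W. \<forall>b\<in>W. a + b \<in> W) \<and> (\<forall>a\<in>W. \<forall>c. scale c a \<in> W)"

lemma scale_simps:
  "scale 0 a = 0" "scale 1 a = a" "scale c (a + b) = scale c a + scale c b"
  "scale (c + d) a = scale c a + scale d a" "scale (c * d) a = scale c (scale d a)"
  "scale c a * b = scale c (a * b)" "scale c 0 = 0"
proof -
  have "[:c + d:] = [:c:] + [:d:]" by simp
  then show "scale (c + d) a = scale c a + scale d a"
    unfolding scale_def by (simp only: to_fract_add smult_add_left)
  have "[:c * d:] = [:c:] * [:d:]" by simp
  then show "scale (c * d) a = scale c (scale d a)"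
    unfolding scale_def by (simp only: to_fract_mult smult_smult)
  show "scale 1 a = a" by (simp add: scale_def flip: one_pCons)
qed (simp_all add: scale_def smult_add_right)

lemma lin_closed_scale: "lin_closed W \<Longrightarrow> a \<in> W \<Longrightarrow> scale c a \<in> W"
  by (simp add: lin_closed_def)

lemma lin_closed_uminus: "lin_closed W \<Longrightarrow> a \<in> W \<Longrightarrow> - a \<in> W"
proof -
  assume "lin_closed W" "a \<in> W"
  then have "scale (-1) a \<in> W" by (auto simp: lin_closed_def)
  moreover have "a + scale (-1) a = 0"
    using scale_simps(4)[of 1 "-1" a] by (simp add: scale_simps(1,2))
  ultimately show ?thesis by (metis add.inverse_unique)
qed

lemma class_field: "field complex_field"
  by (rule class_field.field_axioms)

lemma vectorspace_rfun_module:
  assumes "lin_closed W" shows "vectorspace complex_field (rfun_module W)"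
proof (rule vs_criteria)
  show "field complex_field" by (rule class_field)
  show "\<forall>v\<in>carrier (rfun_module W). \<exists>neg_v\<in>carrier (rfun_module W). v \<oplus>\<^bsub>rfun_module W\<^esub> neg_v = \<zero>\<^bsub>rfun_module W\<^esub>"
    using lin_closed_uminus[OF assms] by (auto intro!: bexI[of _ "- _"])
qed (use assms in \<open>auto simp: lin_closed_def scale_simps algebra_simps\<close>)

lemma lin_closed_sum:
  "lin_closed W \<Longrightarrow> (\<And>i. i \<in> I \<Longrightarrow> f i \<in> W) \<Longrightarrow> sum f I \<in> W"
  by (induction I rule: infinite_finite_induct) (auto simp: lin_closed_def)

lemma finsum_rfun_module:
  assumes "lin_closed W" "finite I" "\<And>i. i \<in> I \<Longrightarrow> f i \<in> W"
  shows "finsum (rfun_module W) f I = sum f I"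
proof -
  interpret vectorspace complex_field "rfun_module W" by (rule vectorspace_rfun_module[OF assms(1)])
  show ?thesis using assms(2,3)
  proof (induction I)
    case (insert i I)
    then show ?case using M.finsum_insert[of I i f] by auto
  qed (use M.finsum_empty in simp)
qed

lemma lincomb_rfun_module:
  assumes "lin_closed W" "finite S" "S \<subseteq> W"
  shows "module.lincomb (rfun_module W) a S = (\<Sum>v\<in>S. scale (a v) v)"
proof -
  interpret vectorspace complex_field "rfun_module W" by (rule vectorspace_rfun_module[OF assms(1)])
  show ?thesis unfolding lincomb_def
    using assms by (subst finsum_rfun_module) (auto simp: lin_closed_def)
qed

section \<open>Rational functions with a common denominator\<close>

definition homog :: "complex poly \<Rightarrow> nat \<Rightarrow> complex poly \<Rightarrow> rfun poly" where
  "homog D m p = Polynomial.monom (to_fract p / to_fract D) m"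

text \<open>The sections of a divisor of degree \<open>d\<close> on the projective line: the poles
  at finite points are bounded by the roots of \<open>D\<close>, the pole at infinity by
  \<open>d - degree D\<close>.\<close>

definition homog_space :: "complex poly \<Rightarrow> nat \<Rightarrow> nat \<Rightarrow> rfun poly set" where
  "homog_space D m d = homog D m ` {p. degree p \<le> d}"

lemma homog_0: "homog D m 0 = 0"
  and homog_add: "homog D m (p + q) = homog D m p + homog D m q"
  and homog_scale: "homog D m (Polynomial.smult c p) = scale c (homog D m p)"
  and homog_mult: "homog D m p * homog E n q = homog (D * E) (m + n) (p * q)"
  and homog_cancel: "r \<noteq> 0 \<Longrightarrow> homog (D * r) m (p * r) = homog D m p"
  and homog_eq_0: "D \<noteq> 0 \<Longrightarrow> homog D m p = 0 \<longleftrightarrow> p = 0"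
proof -
  have "to_fract (Polynomial.smult c p) = to_fract [:c:] * to_fract p"
    unfolding to_fract_mult[symmetric] by simp
  then show "homog D m (Polynomial.smult c p) = scale c (homog D m p)"
    by (simp add: homog_def scale_def smult_monom)
qed (auto simp: homog_def add_divide_distrib add_monom mult_monom)

lemma homog_sum: "homog D m (sum f I) = (\<Sum>i\<in>I. homog D m (f i))"
  by (induction I rule: infinite_finite_induct) (auto simp: homog_0 homog_add)

lemma inj_homog: "D \<noteq> 0 \<Longrightarrow> inj (homog D m)"
  by (auto simp: inj_def homog_def)

lemma inj_homog_monom: "D \<noteq> 0 \<Longrightarrow> inj_on (\<lambda>j. homog D m (Polynomial.monom 1 j)) I"
  by (rule inj_onI) (auto dest!: injD[OF inj_homog] simp: monom_eq_iff')

lemma homog_monom_homog_space: "j \<le> d \<Longrightarrow> homog D m (Polynomial.monom 1 j) \<in> homog_space D m d"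
  unfolding homog_space_def by (rule imageI) (simp add: degree_monom_eq)

lemma lin_closed_homog_space: "lin_closed (homog_space D m d)"
  unfolding lin_closed_def homog_space_def
proof (intro conjI ballI allI)
  show "0 \<in> homog D m ` {p. degree p \<le> d}" by (rule image_eqI[of _ _ 0]) (auto simp: homog_0)
  fix a b c assume "a \<in> homog D m ` {p. degree p \<le> d}"
  then obtain p where p: "a = homog D m p" "degree p \<le> d" by blast
  show "scale c a \<in> homog D m ` {p. degree p \<le> d}"
    unfolding p(1) homog_scale[symmetric] using p(2) degree_smult_le[of c p] by (intro imageI) auto
  assume "b \<in> homog D m ` {p. degree p \<le> d}"
  then obtain q where q: "b = homog D m q" "degree q \<le> d" by blast
  show "a + b \<in> homog D m ` {p. degree p \<le> d}"
    unfolding p(1) q(1) homog_add[symmetric] using p(2) q(2) by (intro imageI) (simp add: degree_add_le)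
qed

lemma homog_expand:
  assumes "degree p \<le> d"
  shows "homog D m p = (\<Sum>j\<le>d. scale (Polynomial.coeff p j) (homog D m (Polynomial.monom 1 j)))"
proof -
  have "p = (\<Sum>j\<le>d. Polynomial.smult (Polynomial.coeff p j) (Polynomial.monom 1 j))"
    using poly_as_sum_of_monoms'[OF assms] by (simp add: smult_monom)
  then have "homog D m p = homog D m (\<Sum>j\<le>d. Polynomial.smult (Polynomial.coeff p j) (Polynomial.monom 1 j))"
    by simp
  then show ?thesis unfolding homog_sum homog_scale .
qed

text \<open>The functions x^j / D with \<open>j \<le> d\<close> form a basis.\<close>

lemma homog_space_dim:
  assumes D: "D \<noteq> 0"
  shows "cdim (rfun_module V) (homog_space D m d) = Suc d" "cfin_dim (rfun_module V) (homog_space D m d)"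
proof -
  let ?W = "homog_space D m d"
  define b where "b j = homog D m (Polynomial.monom 1 j)" for j
  define S where "S = b ` {..d}"
  note W = lin_closed_homog_space[of D m d]
  interpret vectorspace complex_field "rfun_module ?W" by (rule vectorspace_rfun_module[OF W])
  have inj: "inj_on b I" for I
    using inj_homog_monom[OF D] unfolding b_def .
  have S: "finite S" "S \<subseteq> ?W"
    by (auto simp: S_def b_def homog_monom_homog_space)
  have lc: "lincomb a S = homog D m (\<Sum>j\<le>d. Polynomial.monom (a (b j)) j)" for a
  proof -
    have "lincomb a S = (\<Sum>j\<le>d. scale (a (b j)) (b j))"
      unfolding lincomb_rfun_module[OF W S] unfolding S_def by (simp add: sum.reindex[OF inj])
    also have "\<dots> = homog D m (\<Sum>j\<le>d. Polynomial.monom (a (b j)) j)"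
      unfolding homog_sum
    proof (rule sum.cong[OF refl])
      fix j
      have "Polynomial.monom (a (b j)) j = Polynomial.smult (a (b j)) (Polynomial.monom 1 j)"
        by (simp add: smult_monom)
      then show "scale (a (b j)) (b j) = homog D m (Polynomial.monom (a (b j)) j)"
        by (simp only: homog_scale b_def[symmetric])
    qed
    finally show ?thesis .
  qed
  have indep: "lin_indpt S"
  proof (rule finite_lin_indpt2)
    fix a assume "lincomb a S = \<zero>\<^bsub>rfun_module ?W\<^esub>"
    then have *: "(\<Sum>j\<le>d. Polynomial.monom (a (b j)) j) = 0" unfolding lc by (simp add: homog_eq_0[OF D])
    have "a (b j) = 0" if "j \<le> d" for j
      using arg_cong[OF *, of "\<lambda>p. Polynomial.coeff p j"] that by (simp add: coeff_sum)
    then show "\<forall>v\<in>S. a v = \<zero>\<^bsub>complex_field\<^esub>" by (auto simp: S_def)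
  qed (use S in auto)
  have gen: "gen_set S"
  proof
    show "span S \<subseteq> carrier (rfun_module ?W)" using S by (intro span_is_subset2) simp
    show "carrier (rfun_module ?W) \<subseteq> span S"
    proof
      fix x assume "x \<in> carrier (rfun_module ?W)"
      then obtain p where p: "x = homog D m p" "degree p \<le> d" by (auto simp: homog_space_def)
      \<comment> \<open>Coefficient functions take vectors as arguments, so the exponent is
        recovered from the basis vector.\<close>
      define a where "a v = Polynomial.coeff p (inv_into UNIV b v)" for v
      have "a (b j) = Polynomial.coeff p j" for j by (simp add: a_def inv_into_f_f[OF inj])
      then have "x = lincomb a S"
        unfolding lc p(1) using poly_as_sum_of_monoms'[OF p(2)] by simp
      then show "x \<in> span S" using S(1) unfolding span_def by auto
    qed
  qed
  have "basis S" unfolding basis_def using indep gen S by auto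
  then have "dim = card S" by (rule dim_basis[OF S(1)])
  moreover have "card S = Suc d" unfolding S_def by (simp add: card_image[OF inj])
  ultimately show "cdim (rfun_module V) ?W = Suc d" by (simp add: cdim_def)
  show "cfin_dim (rfun_module V) ?W" using S gen by (auto simp: cfin_dim_def fin_dim_def)
qed

section \<open>Degrees of the rounded-down divisors\<close>

lemma sum_powers_half: "(\<Sum>i<K. (1 / 2 :: real) ^ i) = 2 - 2 / 2 ^ K"
  by (induction K) (auto simp: field_simps)

text \<open>The exponent \<open>n div 2 ^ i\<close> is the coefficient of the point \<open>i\<close> in \<open>\<lfloor>n D\<rfloor>\<close>, the summand \<open>n\<close> of
  \<open>numer_degree n\<close> that of \<open>\<infinity>\<close>.\<close>

definition denom :: "nat \<Rightarrow> complex poly" where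
  "denom n = (\<Prod>i<n. [:- of_nat i, 1:] ^ (n div 2 ^ i))"

definition numer_degree :: "nat \<Rightarrow> nat" where
  "numer_degree n = n + degree (denom n)"

text \<open>Factors with \<open>i \<ge> n\<close> have exponent 0 because \<open>n < 2 ^ n\<close>.
  A common range makes denominators of different degrees comparable.\<close>

lemma denom_superset: "n \<le> K \<Longrightarrow> denom n = (\<Prod>i<K. [:- of_nat i, 1:] ^ (n div 2 ^ i))"
  unfolding denom_def
proof (rule prod.mono_neutral_left)
  show "\<forall>i\<in>{..<K} - {..<n}. [:- of_nat i, 1:] ^ (n div 2 ^ i) = (1 :: complex poly)"
  proof
    fix i assume "i \<in> {..<K} - {..<n}"
    then have "n < 2 ^ i" using less_exp[of i] by (auto intro: le_less_trans)
    then show "[:- of_nat i, 1:] ^ (n div 2 ^ i) = (1 :: complex poly)" by simp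
  qed
qed auto

lemma denom_nonzero: "denom n \<noteq> 0"
  by (simp add: denom_def)

lemma degree_denom: "degree (denom n) = (\<Sum>i<n. n div 2 ^ i)"
  unfolding denom_def by (subst degree_prod_eq_sum_degree) (auto simp: degree_linear_power)

text \<open>Superadditivity of rounding down: floor(m D) + floor(n D) is at most floor((m + n)
  D).\<close>

lemma denom_add: "\<exists>r. denom (m + n) = denom m * denom n * r"
proof -
  let ?l = "\<lambda>i. [:- of_nat i, 1:] :: complex poly"
  \<comment> \<open>The carry, 0 or 1, from adding the two remainders; \<open>e\<close> shows that
    the truncated subtraction is exact.\<close>
  let ?e = "\<lambda>i. (m + n) div 2 ^ i - m div 2 ^ i - n div 2 ^ i"
  have e: "(m + n) div 2 ^ i = m div 2 ^ i + n div 2 ^ i + ?e i" for i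
    using div_add1_eq[of m n "2 ^ i"] by simp
  have "denom (m + n) = (\<Prod>i<m + n. ?l i ^ (m div 2 ^ i + n div 2 ^ i + ?e i))"
    unfolding denom_def by (intro prod.cong refl arg_cong2[where f = "(^)"] e)
  also have "\<dots> = denom m * denom n * (\<Prod>i<m + n. ?l i ^ ?e i)"
    by (simp add: denom_superset[of m "m + n"] denom_superset[of n "m + n"] power_add prod.distrib)
  finally show ?thesis by blast
qed

text \<open>In the factor 3, infinity accounts for 1 and the geometric series of weights for
  2.\<close>

lemma numer_degree_le: "numer_degree n \<le> 3 * n"
proof -
  have "real (\<Sum>i<n. n div 2 ^ i) \<le> (\<Sum>i<n. real n * (1 / 2) ^ i)"
    unfolding of_nat_sum
  proof (rule sum_mono)
    fix i
    have "real (n div 2 ^ i) \<le> real n / real (2 ^ i)" by (rule of_nat_div_le_of_nat)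
    then show "real (n div 2 ^ i) \<le> real n * (1 / 2) ^ i" by (simp add: power_one_over)
  qed
  also have "\<dots> = real n * (2 - 2 / 2 ^ n)" unfolding sum_distrib_left[symmetric] sum_powers_half ..
  also have "\<dots> \<le> real n * 2" by (intro mult_left_mono) auto
  finally have "(\<Sum>i<n. n div 2 ^ i) \<le> 2 * n" by linarith
  then show ?thesis by (simp add: numer_degree_def degree_denom)
qed

text \<open>Only the first \<open>K\<close> finite points are kept: rounding loses at most 1 at each
  of them, and the tail of the weights sums to \<open>2 / 2 ^ K\<close>.\<close>

lemma numer_degree_ge:
  assumes "K \<le> n"
  shows "real (numer_degree n) \<ge> 3 * real n - 2 * real n / 2 ^ K - real K"
proof -
  have "real n * (2 - 2 / 2 ^ K) - real K = (\<Sum>i<K. real n * (1 / 2) ^ i - 1)"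
    unfolding sum_subtractf sum_distrib_left[symmetric] sum_powers_half by simp
  also have "\<dots> \<le> (\<Sum>i<K. real (n div 2 ^ i))"
  proof (rule sum_mono)
    fix i
    have "real n < real (2 ^ i + 2 ^ i * (n div 2 ^ i))"
      unfolding of_nat_less_iff by (rule dividend_less_times_div) simp
    then show "real n * (1 / 2) ^ i - 1 \<le> real (n div 2 ^ i)"
      by (simp add: power_one_over field_simps)
  qed
  also have "\<dots> \<le> (\<Sum>i<n. real (n div 2 ^ i))" using assms by (intro sum_mono2) auto
  finally show ?thesis by (simp add: numer_degree_def degree_denom algebra_simps)
qed

section \<open>The graded algebra\<close>

definition divisor_gr :: "nat \<Rightarrow> rfun poly set" where
  "divisor_gr n = homog_space (denom n) n (numer_degree n)"

definition divisor_carrier :: "rfun poly set" where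
  "divisor_carrier = {q. \<forall>n. Polynomial.monom (Polynomial.coeff q n) n \<in> divisor_gr n}"

lemma divisor_gr_0: "0 \<in> divisor_gr n"
  using lin_closed_homog_space by (auto simp: divisor_gr_def lin_closed_def)

lemma divisor_gr_monom: "x \<in> divisor_gr n \<Longrightarrow> x = Polynomial.monom (Polynomial.coeff x n) n"
  by (auto simp: divisor_gr_def homog_space_def homog_def)

text \<open>The surplus factor \<open>r\<close> brings the product onto the denominator of degree
  \<open>m + n\<close>, and the bound on the numerator grows by exactly
  \<open>degree r\<close>.\<close>

lemma divisor_gr_mult:
  assumes "x \<in> divisor_gr m" "y \<in> divisor_gr n"
  shows "x * y \<in> divisor_gr (m + n)"
proof -
  obtain p where p: "x = homog (denom m) m p" "degree p \<le> numer_degree m" using assms(1) by (auto simp: divisor_gr_def homog_space_def)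
  obtain q where q: "y = homog (denom n) n q" "degree q \<le> numer_degree n" using assms(2) by (auto simp: divisor_gr_def homog_space_def)
  obtain r where r: "denom (m + n) = denom m * denom n * r" using denom_add by blast
  have r0: "r \<noteq> 0" using r denom_nonzero[of "m + n"] by auto
  have "x * y = homog (denom (m + n)) (m + n) (p * q * r)"
    unfolding p(1) q(1) homog_mult r homog_cancel[OF r0] ..
  moreover have "degree (p * q * r) \<le> numer_degree (m + n)"
  proof -
    have "degree (p * q * r) \<le> degree p + degree q + degree r"
      using degree_mult_le[of "p * q" r] degree_mult_le[of p q] by linarith
    also have "\<dots> \<le> numer_degree (m + n)"
      using p(2) q(2) r0 unfolding numer_degree_def r by (simp add: degree_mult_eq denom_nonzero)
    finally show ?thesis .
  qed
  ultimately show ?thesis by (auto simp: divisor_gr_def homog_space_def)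
qed

lemma one_divisor_gr: "1 \<in> divisor_gr 0"
proof -
  have "denom 0 = 1" by (simp add: denom_def)
  then have "1 = homog (denom 0) 0 1" by (simp add: homog_def)
  then show ?thesis by (auto simp: divisor_gr_def homog_space_def)
qed

lemma lin_closed_divisor_gr: "lin_closed (divisor_gr n)"
  unfolding divisor_gr_def by (rule lin_closed_homog_space)

lemma lin_closed_divisor_carrier: "lin_closed divisor_carrier"
  unfolding lin_closed_def
proof (intro conjI ballI allI)
  show "0 \<in> divisor_carrier" using divisor_gr_0 by (simp add: divisor_carrier_def)
  fix a b c assume a: "a \<in> divisor_carrier"
  have "scale c (Polynomial.monom (Polynomial.coeff a n) n) \<in> divisor_gr n" for n
    using lin_closed_divisor_gr[of n] a by (auto simp: lin_closed_def divisor_carrier_def)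
  then show "scale c a \<in> divisor_carrier" by (simp add: divisor_carrier_def scale_def smult_monom)
  assume b: "b \<in> divisor_carrier"
  have "Polynomial.monom (Polynomial.coeff a n) n + Polynomial.monom (Polynomial.coeff b n) n \<in> divisor_gr n" for n
    using lin_closed_divisor_gr[of n] a b by (auto simp: lin_closed_def divisor_carrier_def)
  then show "a + b \<in> divisor_carrier" by (simp add: divisor_carrier_def add_monom)
qed

lemma divisor_gr_subset: "divisor_gr n \<subseteq> divisor_carrier"
proof
  fix x assume x: "x \<in> divisor_gr n"
  have "Polynomial.coeff x m = 0" if "m \<noteq> n" for m
    using that by (subst divisor_gr_monom[OF x]) simp
  then have "Polynomial.monom (Polynomial.coeff x m) m \<in> divisor_gr m" for m
    using x divisor_gr_monom[OF x] divisor_gr_0 by (cases "m = n") auto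
  then show "x \<in> divisor_carrier" by (simp add: divisor_carrier_def)
qed

lemma monom_sum_coeff:
  "Polynomial.monom (\<Sum>i\<in>I. f i) n = (\<Sum>i\<in>I. Polynomial.monom (f i) n)"
  by (induction I rule: infinite_finite_induct) (auto simp: add_monom[symmetric])

lemma divisor_carrier_mult: "x \<in> divisor_carrier \<Longrightarrow> y \<in> divisor_carrier \<Longrightarrow> x * y \<in> divisor_carrier"
proof -
  assume x: "x \<in> divisor_carrier" and y: "y \<in> divisor_carrier"
  have "Polynomial.monom (Polynomial.coeff x i * Polynomial.coeff y (n - i)) n \<in> divisor_gr n" if "i \<le> n" for i n
  proof -
    have "Polynomial.monom (Polynomial.coeff x i) i * Polynomial.monom (Polynomial.coeff y (n - i)) (n - i)
      \<in> divisor_gr (i + (n - i))"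
      using x y by (intro divisor_gr_mult) (auto simp: divisor_carrier_def)
    then show ?thesis using that by (simp add: mult_monom)
  qed
  then show "x * y \<in> divisor_carrier"
    unfolding divisor_carrier_def by (auto simp: coeff_mult monom_sum_coeff intro!: lin_closed_sum[OF lin_closed_divisor_gr])
qed

abbreviation divisor_algebra :: "(complex, rfun poly) module" where "divisor_algebra \<equiv> rfun_module divisor_carrier"

lemma one_divisor_carrier: "1 \<in> divisor_carrier" using one_divisor_gr divisor_gr_subset by blast

lemma cring_divisor_algebra: "cring divisor_algebra"
proof (rule cringI)
  show "abelian_group divisor_algebra"
    using vectorspace_rfun_module[OF lin_closed_divisor_carrier] by (simp add: vectorspace_def Module.module_def)
  show "comm_monoid divisor_algebra"
    by (rule comm_monoidI) (auto simp: divisor_carrier_mult one_divisor_carrier mult_ac)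
qed (simp add: distrib_right)

lemma finprod_divisor_algebra:
  assumes "finite I" "\<And>i. i \<in> I \<Longrightarrow> f i \<in> divisor_carrier"
  shows "finprod divisor_algebra f I = prod f I"
proof -
  interpret cring divisor_algebra by (rule cring_divisor_algebra)
  show ?thesis using assms
  proof (induction I)
    case (insert i I)
    then show ?case using finprod_insert[of I i f] by auto
  qed simp
qed

lemma graded_algebra_divisor_algebra: "graded_algebra divisor_algebra divisor_gr"
  unfolding graded_algebra_def
proof (intro conjI ballI allI)
  note vs = vectorspace_rfun_module[OF lin_closed_divisor_carrier]
  have mod: "Module.module complex_field divisor_algebra" using vs by (simp add: vectorspace_def)
  show "Module.algebra complex_field divisor_algebra"
    using mod cring_divisor_algebra by (simp add: algebra_def algebra_axioms_def scale_simps)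
  show "VectorSpace.subspace complex_field (divisor_gr n) divisor_algebra" for n
    using vs mod divisor_gr_subset[of n] lin_closed_divisor_gr[of n]
    by (simp add: VectorSpace.subspace_def submodule_def lin_closed_def)
  show "\<one>\<^bsub>divisor_algebra\<^esub> \<in> divisor_gr 0" using one_divisor_gr by simp
  show "x \<otimes>\<^bsub>divisor_algebra\<^esub> y \<in> divisor_gr (m + n)" if "x \<in> divisor_gr m" "y \<in> divisor_gr n" for m n x y
    using divisor_gr_mult[OF that] by simp
  fix x assume x: "x \<in> carrier divisor_algebra"
  have sum: "finsum divisor_algebra f {n. f n \<noteq> 0} = (\<Sum>n | f n \<noteq> 0. f n)"
    if "\<forall>n. f n \<in> divisor_gr n" "finite {n. f n \<noteq> 0}" for f
    using that divisor_gr_subset by (intro finsum_rfun_module[OF lin_closed_divisor_carrier]) auto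
  show "\<exists>!f. (\<forall>n. f n \<in> divisor_gr n) \<and> finite {n. f n \<noteq> \<zero>\<^bsub>divisor_algebra\<^esub>} \<and> x = finsum divisor_algebra f {n. f n \<noteq> \<zero>\<^bsub>divisor_algebra\<^esub>}"
  proof (rule ex1I)
    let ?f = "\<lambda>n. Polynomial.monom (Polynomial.coeff x n) n"
    have "{n. ?f n \<noteq> 0} \<subseteq> {..degree x}" using le_degree by (auto simp: monom_eq_0_iff)
    then have fin: "finite {n. ?f n \<noteq> 0}" by (rule finite_subset) simp
    have "x = (\<Sum>n\<le>degree x. ?f n)" by (simp add: poly_as_sum_of_monoms)
    also have "\<dots> = (\<Sum>n | ?f n \<noteq> 0. ?f n)"
      using \<open>{n. ?f n \<noteq> 0} \<subseteq> {..degree x}\<close> by (intro sum.mono_neutral_right) auto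
    finally show "(\<forall>n. ?f n \<in> divisor_gr n) \<and> finite {n. ?f n \<noteq> \<zero>\<^bsub>divisor_algebra\<^esub>} \<and> x = finsum divisor_algebra ?f {n. ?f n \<noteq> \<zero>\<^bsub>divisor_algebra\<^esub>}"
      using x fin sum[of ?f] by (simp add: divisor_carrier_def)
  next
    fix f assume "(\<forall>n. f n \<in> divisor_gr n) \<and> finite {n. f n \<noteq> \<zero>\<^bsub>divisor_algebra\<^esub>} \<and> x = finsum divisor_algebra f {n. f n \<noteq> \<zero>\<^bsub>divisor_algebra\<^esub>}"
    then have f: "\<And>n. f n \<in> divisor_gr n" "finite {n. f n \<noteq> 0}" "x = (\<Sum>n | f n \<noteq> 0. f n)"
      using sum[of f] by auto
    show "f = (\<lambda>n. Polynomial.monom (Polynomial.coeff x n) n)"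
    proof
      fix n
      have c: "Polynomial.coeff (f m) n = (if m = n then Polynomial.coeff (f n) n else 0)" for m
        using arg_cong[OF divisor_gr_monom[OF f(1)[of m]], of "\<lambda>q. Polynomial.coeff q n"] by auto
      have "Polynomial.coeff x n = (\<Sum>m | f m \<noteq> 0. Polynomial.coeff (f m) n)"
        unfolding f(3) coeff_sum ..
      also have "\<dots> = Polynomial.coeff (f n) n"
        unfolding sum.cong[OF refl c] using f(2) by auto
      finally show "f n = Polynomial.monom (Polynomial.coeff x n) n" using divisor_gr_monom[OF f(1)[of n]] by simp
    qed
  qed
qed

lemma domain_divisor_algebra: "domain divisor_algebra"
  using cring_divisor_algebra by (simp add: domain_def domain_axioms_def)

section \<open>Images of symmetric powers and approximability\<close>

lemma bounded_composition:
  "j \<le> n * b \<Longrightarrow> \<exists>g. (\<forall>i<n. g i \<le> b) \<and> (\<Sum>i<n. g i) = (j :: nat)"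
proof (induction n arbitrary: j)
  case (Suc n)
  \<comment> \<open>Greedy choice: the last entry takes as much of \<open>j\<close> as the bound
    allows.\<close>
  have "j - min j b \<le> n * b" using Suc.prems by auto
  then obtain g where g: "\<forall>i<n. g i \<le> b" "(\<Sum>i<n. g i) = j - min j b" using Suc.IH by blast
  then have "(\<forall>i<Suc n. (g(n := min j b)) i \<le> b) \<and> (\<Sum>i<Suc n. (g(n := min j b)) i) = j"
    by (auto simp: less_Suc_eq)
  then show ?case by blast
qed simp

lemma homog_prod: "(\<Prod>i<n. homog D m (p i)) = homog (D ^ n) (n * m) (\<Prod>i<n. p i)"
proof (induction n)
  case 0
  then show ?case by (simp add: homog_def)
next
  case (Suc n)
  then show ?case by (simp add: homog_mult mult_ac add.commute)
qed

lemma divisor_gr_sequence: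
  assumes "\<forall>i<n. w i \<in> divisor_gr p"
  obtains q where "\<And>i. i < n \<Longrightarrow> w i = homog (denom p) p (q i) \<and> degree (q i) \<le> numer_degree p"
proof -
  have "\<forall>i. \<exists>q. i < n \<longrightarrow> w i = homog (denom p) p q \<and> degree q \<le> numer_degree p"
    using assms by (auto simp: divisor_gr_def homog_space_def)
  then show ?thesis using that by metis
qed

text \<open>Multiplication of sections on the projective line is surjective: each x^j over
  \<open>denom p ^ n\<close> is a product of \<open>n\<close> monomials over \<open>denom p\<close>,
  with \<open>j\<close> distributed by \<open>bounded_composition\<close>.\<close>

lemma sym_power_image_divisor_gr:
  "sym_power_image divisor_algebra n (divisor_gr p) = homog_space (denom p ^ n) (n * p) (n * numer_degree p)"
proof -
  interpret vectorspace complex_field divisor_algebra by (rule vectorspace_rfun_module[OF lin_closed_divisor_carrier])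
  let ?G = "{finprod divisor_algebra w {..<n} | w. \<forall>i<n. w i \<in> divisor_gr p}"
  let ?P = "homog_space (denom p ^ n) (n * p) (n * numer_degree p)"
  have fp: "finprod divisor_algebra w {..<n} = prod w {..<n}" if "\<forall>i<n. w i \<in> divisor_gr p" for w
    using that divisor_gr_subset by (intro finprod_divisor_algebra) auto
  have GC: "?G \<subseteq> divisor_carrier"
  proof -
    have "prod w I \<in> divisor_carrier" if "\<forall>i\<in>I. w i \<in> divisor_carrier" for w and I :: "nat set"
      using that by (induction I rule: infinite_finite_induct) (auto simp: one_divisor_carrier divisor_carrier_mult)
    then have "prod w {..<n} \<in> divisor_carrier" if "\<forall>i<n. w i \<in> divisor_gr p" for w
      using that divisor_gr_subset by blast
    then show ?thesis using fp by auto
  qed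
  have GP: "?G \<subseteq> ?P"
  proof
    fix x assume "x \<in> ?G"
    then obtain w where w: "x = prod w {..<n}" "\<forall>i<n. w i \<in> divisor_gr p" using fp by auto
    from w(2) obtain q where q: "\<And>i. i < n \<Longrightarrow> w i = homog (denom p) p (q i) \<and> degree (q i) \<le> numer_degree p"
      using divisor_gr_sequence by blast
    have "x = (\<Prod>i<n. homog (denom p) p (q i))" unfolding w(1) using q by (intro prod.cong) auto
    also have "\<dots> = homog (denom p ^ n) (n * p) (\<Prod>i<n. q i)" by (rule homog_prod)
    finally have x: "x = homog (denom p ^ n) (n * p) (\<Prod>i<n. q i)" .
    have "degree (\<Prod>i<n. q i) \<le> (\<Sum>i<n. degree (q i))" using degree_prod_sum_le[of "{..<n}" q] by (simp add: o_def)
    also have "\<dots> \<le> (\<Sum>i<n. numer_degree p)" using q by (intro sum_mono) auto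
    finally show "x \<in> ?P" unfolding x homog_space_def by (intro imageI) simp
  qed
  show ?thesis unfolding sym_power_image_def
  proof (intro equalityI subsetI)
    fix x assume "x \<in> span ?G"
    then obtain a A where A: "finite A" "A \<subseteq> ?G" "x = lincomb a A" unfolding span_def by blast
    then have "x = (\<Sum>v\<in>A. scale (a v) v)" using GC by (simp add: lincomb_rfun_module[OF lin_closed_divisor_carrier])
    also have "\<dots> \<in> ?P"
    proof (rule lin_closed_sum[OF lin_closed_homog_space])
      fix v assume "v \<in> A"
      then have "v \<in> ?P" using A(2) GP by blast
      then show "scale (a v) v \<in> ?P" using lin_closed_homog_space unfolding lin_closed_def by blast
    qed
    finally show "x \<in> ?P" .
  next
    fix x assume "x \<in> ?P"
    then obtain q where q: "x = homog (denom p ^ n) (n * p) q" "degree q \<le> n * numer_degree p" by (auto simp: homog_space_def)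
    define b where "b j = homog (denom p ^ n) (n * p) (Polynomial.monom 1 j)" for j
    have inj: "inj_on b I" for I
      unfolding b_def by (rule inj_homog_monom) (simp add: denom_nonzero)
    have bG: "b j \<in> ?G" if j: "j \<le> n * numer_degree p" for j
    proof -
      obtain g where g: "\<forall>i<n. g i \<le> numer_degree p" "(\<Sum>i<n. g i) = j" using bounded_composition[OF j] by blast
      let ?w = "\<lambda>i. homog (denom p) p (Polynomial.monom 1 (g i))"
      have w: "\<forall>i<n. ?w i \<in> divisor_gr p"
        using g(1) by (simp add: divisor_gr_def homog_monom_homog_space)
      have "(\<Prod>i<n. Polynomial.monom (1::complex) (g i)) = Polynomial.monom 1 (\<Sum>i<n. g i)" for n
        by (induction n) (auto simp: mult_monom)
      then have "b j = prod ?w {..<n}" unfolding homog_prod b_def by (simp add: g(2))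
      then have "b j = finprod divisor_algebra ?w {..<n}" using fp[OF w] by simp
      then show ?thesis using w by blast
    qed
    let ?A = "b ` {..n * numer_degree p}"
    define a where "a v = Polynomial.coeff q (inv_into UNIV b v)" for v
    have "a (b j) = Polynomial.coeff q j" for j by (simp add: a_def inv_into_f_f[OF inj])
    then have "x = (\<Sum>v\<in>?A. scale (a v) v)"
      unfolding q(1) homog_expand[OF q(2)] b_def[symmetric] by (simp add: sum.reindex[OF inj])
    also have "\<dots> = lincomb a ?A" using bG GC by (subst lincomb_rfun_module[OF lin_closed_divisor_carrier]) auto
    finally show "x \<in> span ?G" using bG unfolding span_def by auto
  qed
qed

text \<open>The dimensions are known exactly, and for every \<open>n\<close> their ratio is at least
  \<open>numer_degree p / (3 * p)\<close>, which \<open>numer_degree_ge\<close> brings above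
  \<open>1 - \<epsilon>\<close>.\<close>

lemma approximable_divisor_algebra: "approximable divisor_algebra divisor_gr"
  unfolding approximable_def
proof (intro conjI allI impI)
  show "graded_algebra divisor_algebra divisor_gr" by (rule graded_algebra_divisor_algebra)
  show "domain divisor_algebra" by (rule domain_divisor_algebra)
  show "cfin_dim divisor_algebra (divisor_gr n)" for n unfolding divisor_gr_def by (rule homog_space_dim[OF denom_nonzero])
  have "homog (denom n) n 1 \<in> divisor_gr n" "homog (denom n) n 1 \<noteq> 0" for n
    by (auto simp: divisor_gr_def homog_space_def homog_eq_0 denom_nonzero)
  then show "\<exists>n0. \<forall>n\<ge>n0. divisor_gr n \<noteq> {\<zero>\<^bsub>divisor_algebra\<^esub>}" by (metis rfun_module_simps(4) singletonD)
  fix \<epsilon> :: real assume \<epsilon>: "\<epsilon> > 0"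
  \<comment> \<open>\<open>K\<close> makes the tail loss \<open>2 * p / 2 ^ K\<close> smaller than
    \<open>2 * p * \<epsilon>\<close>; then \<open>p1\<close> makes the rounding loss
    \<open>K\<close> smaller than \<open>p * \<epsilon>\<close>.\<close>
  obtain K where K: "(1 / 2) ^ K < \<epsilon>" using real_arch_pow_inv[OF \<epsilon>, of "1 / 2"] by auto
  obtain p1 :: nat where p1: "real K < p1 * \<epsilon>" using ex_less_of_nat_mult[OF \<epsilon>, of "real K"] by blast
  show "\<exists>p0. \<forall>p\<ge>p0. liminf (\<lambda>n. ereal (real (cdim divisor_algebra (sym_power_image divisor_algebra n (divisor_gr p)))
    / real (cdim divisor_algebra (divisor_gr (n * p))))) > ereal (1 - \<epsilon>)"
  proof (intro exI allI impI)
    fix p assume p: "p \<ge> Suc (max K p1)"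
    have dims: "cdim divisor_algebra (sym_power_image divisor_algebra n (divisor_gr p)) = Suc (n * numer_degree p)" "cdim divisor_algebra (divisor_gr (n * p)) = Suc (numer_degree (n * p))" for n
      unfolding sym_power_image_divisor_gr by (simp_all add: divisor_gr_def homog_space_dim denom_nonzero)
    have ge: "real (numer_degree p) / (3 * real p) \<le> real (Suc (n * numer_degree p)) / real (Suc (numer_degree (n * p)))" for n
    proof -
      have "real (numer_degree p) \<le> 3 * real p" using numer_degree_le[of p] by linarith
      \<comment> \<open>This is a / b \<le> (n a + 1) / (n b + 1) for a \<le> b, with denominators
        cleared.\<close>
      then have "real (numer_degree p) * (3 * real n * real p + 1) \<le> 3 * real p * (real n * real (numer_degree p) + 1)"
        by (simp add: algebra_simps)
      then have "real (numer_degree p) / (3 * real p) \<le> (real n * real (numer_degree p) + 1) / (3 * real n * real p + 1)"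
        using p by (simp add: field_simps add_pos_nonneg)
      also have "\<dots> \<le> (real n * real (numer_degree p) + 1) / real (Suc (numer_degree (n * p)))"
      proof (rule divide_left_mono)
        have "real (numer_degree (n * p)) \<le> real (3 * (n * p))" using numer_degree_le of_nat_mono by blast
        then show "real (Suc (numer_degree (n * p))) \<le> 3 * real n * real p + 1" by simp
        show "0 < (3 * real n * real p + 1) * real (Suc (numer_degree (n * p)))"
          by (rule mult_pos_pos) (simp_all add: add_nonneg_pos)
      qed simp
      finally show ?thesis by (simp add: add.commute)
    qed
    have "real K < real p * \<epsilon>"
    proof (rule less_le_trans[OF p1])
      show "real p1 * \<epsilon> \<le> real p * \<epsilon>" using p \<epsilon> by (intro mult_right_mono) auto
    qed
    moreover have "2 * real p * (1 / 2) ^ K < 2 * real p * \<epsilon>"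
      using K p by (intro mult_strict_left_mono) auto
    moreover have "real (numer_degree p) \<ge> 3 * real p - 2 * real p * (1 / 2) ^ K - real K"
      using numer_degree_ge[of K p] p by (simp add: power_one_over)
    ultimately have "3 * real p - 3 * real p * \<epsilon> < real (numer_degree p)" by linarith
    then have "1 - \<epsilon> < real (numer_degree p) / (3 * real p)" using p by (simp add: field_simps)
    then have "ereal (1 - \<epsilon>) < ereal (real (numer_degree p) / (3 * real p))" by simp
    also have "\<dots> \<le> liminf (\<lambda>n. ereal (real (cdim divisor_algebra (sym_power_image divisor_algebra n (divisor_gr p))) / real (cdim divisor_algebra (divisor_gr (n * p)))))"
      unfolding dims using ge by (intro Liminf_bounded always_eventually) auto
    finally show "ereal (1 - \<epsilon>) < liminf (\<lambda>n. ereal (real (cdim divisor_algebra (sym_power_image divisor_algebra n (divisor_gr p)))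
      / real (cdim divisor_algebra (divisor_gr (n * p)))))" .
  qed
qed

section \<open>No embedding into a section ring\<close>

lemma section_ring_simps:
  "carrier (section_ring N X L) = {s. (\<forall>n. s n \<in> global_sections N X (tensor_power n L)) \<and>
    finite {n. s n \<noteq> (\<lambda>i p. 0)}}"
  "(s \<otimes>\<^bsub>section_ring N X L\<^esub> t) n i p = (\<Sum>k\<le>n. s k i p * t (n - k) i p)"
  "(s \<oplus>\<^bsub>section_ring N X L\<^esub> t) n i p = s n i p + t n i p"
  "(c \<odot>\<^bsub>section_ring N X L\<^esub> s) n i p = c * s n i p"
  by (simp_all add: section_ring_def)

lemma tensor_power_1: "tensor_power 1 L = L"
  by (simp add: tensor_power_def)

text \<open>Membership test for a fraction with a smaller denominator: expand it by the missing
  factor \<open>r\<close>.\<close>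

lemma monom_divisor_gr:
  assumes "denom n = D * r" "degree p + degree r \<le> numer_degree n"
  shows "Polynomial.monom (to_fract p / to_fract D) n \<in> divisor_gr n"
proof -
  have "r \<noteq> 0" using assms(1) denom_nonzero[of n] by auto
  then have "Polynomial.monom (to_fract p / to_fract D) n = homog (denom n) n (p * r)"
    unfolding assms(1) by (simp add: homog_cancel) (simp add: homog_def)
  moreover have "degree (p * r) \<le> numer_degree n" using assms(2) degree_mult_le[of p r] by linarith
  ultimately show ?thesis by (auto simp: divisor_gr_def homog_space_def)
qed

lemma T_power_divisor_gr: "Polynomial.monom 1 n \<in> divisor_gr n"
  using monom_divisor_gr[of n 1 "denom n" 1] by (simp add: numer_degree_def)

lemma XT_divisor_gr: "Polynomial.monom (to_fract [:0, 1:]) 1 \<in> divisor_gr 1"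
proof -
  have "denom 1 = [:0, 1:]" by (simp add: denom_def)
  then show ?thesis using monom_divisor_gr[of 1 1 "denom 1" "[:0, 1:]"] by (simp add: numer_degree_def)
qed

text \<open>\<open>2 ^ i\<close> is the first degree in which the coefficient of the point
  \<open>i\<close> rounds down to 1.\<close>

lemma pole_divisor_gr: "Polynomial.monom (1 / to_fract [:- of_nat i, 1:]) (2 ^ i) \<in> divisor_gr (2 ^ i)"
proof -
  let ?l = "[:- of_nat i, 1:] :: complex poly"
  have "?l ^ (2 ^ i div 2 ^ i) dvd denom (2 ^ i)"
    unfolding denom_def using less_exp[of i] by (intro dvd_prodI) auto
  then obtain r where r: "denom (2 ^ i) = ?l * r" by (auto simp: dvd_def)
  have "degree (denom (2 ^ i)) = degree ?l + degree r"
    unfolding r using r denom_nonzero[of "2 ^ i"] by (intro degree_mult_eq) auto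
  then have "Polynomial.monom (to_fract 1 / to_fract ?l) (2 ^ i) \<in> divisor_gr (2 ^ i)"
    by (intro monom_divisor_gr[OF r]) (simp add: numer_degree_def)
  then show ?thesis by simp
qed

lemma not_embeddable:
  assumes X: "projective_variety N X" and L: "line_bundle N X L"
    and \<phi>: "\<phi> \<in> graded_algebra_hom divisor_algebra divisor_gr (section_ring N X L) (section_ring_gr N X L)"
    and inj: "inj_on \<phi> divisor_carrier"
  shows False
proof -
  \<comment> \<open>In the notation of the overview, \<open>s\<close> is the image of
    \<open>t 1\<close>, \<open>u\<close> that of \<open>xt\<close>, and \<sigma> that of the element
    here called \<open>u i\<close>.\<close>
  define t :: "nat \<Rightarrow> rfun poly" where "t n = Polynomial.monom 1 n" for n
  define xt :: "rfun poly" where "xt = Polynomial.monom (to_fract [:0, 1:]) 1"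
  define u :: "nat \<Rightarrow> rfun poly" where "u i = Polynomial.monom (1 / to_fract [:- of_nat i, 1:]) (2 ^ i)" for i
  have mem: "t n \<in> divisor_gr n" "xt \<in> divisor_gr 1" "u i \<in> divisor_gr (2 ^ i)" for n i
    using T_power_divisor_gr XT_divisor_gr pole_divisor_gr by (auto simp: t_def xt_def u_def)
  have in_carrier: "x \<in> divisor_gr n \<Longrightarrow> x \<in> divisor_carrier" for x n using divisor_gr_subset by blast
  have \<phi>_add: "\<phi> (x + y) n i p = \<phi> x n i p + \<phi> y n i p"
    and \<phi>_mult: "\<phi> (x * y) n i p = (\<Sum>k\<le>n. \<phi> x k i p * \<phi> y (n - k) i p)"
    if "x \<in> divisor_carrier" "y \<in> divisor_carrier" for x y n i p
    using \<phi> that by (auto simp: graded_algebra_hom_def Ring.ring_hom_def section_ring_simps)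
  have \<phi>_scale: "\<phi> (scale c x) n i p = c * \<phi> x n i p" if "x \<in> divisor_carrier" for c x n i p
    using \<phi> that by (auto simp: graded_algebra_hom_def section_ring_simps)
  have \<phi>_gr: "\<phi> x \<in> section_ring_gr N X L n" if "x \<in> divisor_gr n" for x n
  proof -
    have "\<phi> ` divisor_gr n \<subseteq> section_ring_gr N X L n" using \<phi> by (simp add: graded_algebra_hom_def)
    then show ?thesis using that by blast
  qed
  have \<phi>_other: "\<phi> x m = (\<lambda>i p. 0)" if "x \<in> divisor_gr n" "m \<noteq> n" for x m n
    using \<phi>_gr[OF that(1)] that(2) by (auto simp: section_ring_gr_def)
  have \<phi>_section: "\<phi> x 1 \<in> global_sections N X L" if "x \<in> divisor_gr 1" for x
  proof -
    have "\<phi> x 1 \<in> global_sections N X (tensor_power 1 L)"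
      using \<phi>_gr[OF that] unfolding section_ring_gr_def section_ring_simps by blast
    then show ?thesis by (simp only: tensor_power_1)
  qed
  have \<phi>_prod: "\<phi> (x * y) (m + n) i p = \<phi> x m i p * \<phi> y n i p"
    if x: "x \<in> divisor_gr m" and y: "y \<in> divisor_gr n" for x y m n i p
  proof -
    have "\<phi> (x * y) (m + n) i p = (\<Sum>k\<le>m + n. \<phi> x k i p * \<phi> y (m + n - k) i p)"
      by (rule \<phi>_mult[OF in_carrier[OF x] in_carrier[OF y]])
    \<comment> \<open>The image of \<open>x\<close> lives in degree \<open>m\<close> only, so the
      convolution has a single term.\<close>
    also have "\<dots> = (\<Sum>k\<in>{m}. \<phi> x k i p * \<phi> y (m + n - k) i p)"
      using \<phi>_other[OF x] by (intro sum.mono_neutral_right) auto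
    finally show ?thesis by simp
  qed
  have \<phi>_0: "\<phi> 0 n i p = 0" for n i p
    using \<phi>_scale[of 0 0 n i p] lin_closed_divisor_carrier by (simp add: scale_simps lin_closed_def)
  have \<phi>_nonzero: "\<exists>i p. \<phi> x n i p \<noteq> 0" if x: "x \<in> divisor_gr n" "x \<noteq> 0" for x n
  proof (rule ccontr)
    assume "\<not> ?thesis"
    then have "\<phi> x m i p = \<phi> 0 m i p" for m i p
      using \<phi>_other[OF x(1), of m] by (cases "m = n") (auto simp: \<phi>_0)
    then have "\<phi> x = \<phi> 0" by (intro ext)
    then show False using inj in_carrier[OF x(1)] in_carrier[OF divisor_gr_0] x(2) by (auto dest: inj_onD)
  qed
  have \<phi>_t: "\<phi> (t (Suc n)) (Suc n) i p = \<phi> (t 1) 1 i p ^ Suc n" for n i p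
  proof (induction n)
    case (Suc n)
    have "t (Suc (Suc n)) = t 1 * t (Suc n)" by (simp add: t_def mult_monom)
    then show ?case using \<phi>_prod[OF mem(1)[of 1] mem(1)[of "Suc n"], of i p] Suc by simp
  qed simp
  have vanish: "\<phi> (t 1) 1 j p = 0" if a: "a \<in> range of_nat" "\<phi> xt 1 j p = a * \<phi> (t 1) 1 j p" for a :: complex and j p
  proof -
    obtain i where i: "a = of_nat i" using a by blast
    \<comment> \<open>The identity (x - a) / (x - a) = 1, multiplied by T^(2^i + 1).\<close>
    have rel: "xt * u i + scale (- a) (t 1 * u i) = t (Suc (2 ^ i))"
    proof -
      have "to_fract [:0, 1:] - to_fract [:a:] = to_fract [:- of_nat i, 1:]"
        by (simp add: i flip: to_fract_diff)
      then have "to_fract [:0, 1:] / to_fract [:- of_nat i, 1:] - to_fract [:a:] / to_fract [:- of_nat i, 1:]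
        = (1 :: rfun)"
        unfolding diff_divide_distrib[symmetric] by simp
      moreover have "to_fract [:- a:] = - to_fract [:a:]" by (simp flip: to_fract_uminus)
      ultimately show ?thesis
        by (simp add: xt_def u_def t_def scale_def mult_monom smult_monom add_monom)
    qed
    let ?n = "1 + 2 ^ i"
    have "\<phi> (t 1) 1 j p ^ Suc (2 ^ i) = \<phi> (xt * u i + scale (- a) (t 1 * u i)) ?n j p"
      unfolding rel using \<phi>_t[of "2 ^ i" j p] by simp
    also have "\<dots> = \<phi> (xt * u i) ?n j p - a * \<phi> (t 1 * u i) ?n j p"
    proof -
      have "xt * u i \<in> divisor_carrier" "t 1 * u i \<in> divisor_carrier" using mem in_carrier divisor_carrier_mult by blast+
      moreover from this have "scale (- a) (t 1 * u i) \<in> divisor_carrier" using lin_closed_divisor_carrier by (auto simp: lin_closed_def)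
      ultimately show ?thesis by (simp add: \<phi>_add \<phi>_scale)
    qed
    also have "\<dots> = (\<phi> xt 1 j p - a * \<phi> (t 1) 1 j p) * \<phi> (u i) (2 ^ i) j p"
      unfolding \<phi>_prod[OF mem(2) mem(3)] \<phi>_prod[OF mem(1) mem(3)] by (simp add: algebra_simps)
    also have "\<dots> = 0" using a(2) by simp
    finally show ?thesis by (rule power_eq_0_iff[THEN iffD1, THEN conjunct1])
  qed
  have "t 1 \<noteq> 0" by (simp add: t_def)
  then obtain i0 p0 where nz: "\<phi> (t 1) 1 i0 p0 \<noteq> 0" using \<phi>_nonzero[OF mem(1)] by blast
  have "infinite (range of_nat :: complex set)" by (simp add: range_inj_infinite inj_of_nat)
  then have "\<exists>c. \<forall>j p. \<phi> xt 1 j p = c * \<phi> (t 1) 1 j p"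
    by (rule sections_proportional[OF X L \<phi>_section[OF mem(1)] \<phi>_section[OF mem(2)] _ _ nz])
      (rule vanish)
  then obtain c where c: "\<And>j p. \<phi> xt 1 j p = c * \<phi> (t 1) 1 j p" by blast
  \<comment> \<open>The element (x - c) T is nonzero, but its image vanishes by the choice of
    \<open>c\<close>.\<close>
  let ?d = "xt + scale (- c) (t 1)"
  have d: "?d \<in> divisor_gr 1" using mem lin_closed_divisor_gr[of 1] by (auto simp: lin_closed_def)
  have "to_fract [:0, 1:] + to_fract [:- c:] = to_fract [:- c, 1:]" by (simp flip: to_fract_add)
  then have "?d \<noteq> 0" by (simp add: xt_def t_def scale_def smult_monom add_monom)
  then obtain j p where "\<phi> ?d 1 j p \<noteq> 0" using \<phi>_nonzero[OF d] by blast
  moreover have tc: "t 1 \<in> divisor_carrier" "xt \<in> divisor_carrier" using mem in_carrier by blast+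
  moreover have "scale (- c) (t 1) \<in> divisor_carrier" by (rule lin_closed_scale[OF lin_closed_divisor_carrier tc(1)])
  ultimately show False using c by (simp add: \<phi>_add \<phi>_scale)
qed

theorem theorem1p2:
  shows "\<exists>(B :: (complex, complex poly fract poly) module) (gr :: nat \<Rightarrow> complex poly fract poly set).
    approximable B gr \<and>
    \<not> (\<exists>N X L \<phi>. projective_variety N X \<and> line_bundle N X L \<and> big N X L \<and>
         \<phi> \<in> graded_algebra_hom B gr (section_ring N X L) (section_ring_gr N X L) \<and>
         inj_on \<phi> (carrier B))"
proof (intro exI conjI)
  show "approximable divisor_algebra divisor_gr" by (rule approximable_divisor_algebra)
  show "\<not> (\<exists>N X L \<phi>. projective_variety N X \<and> line_bundle N X L \<and> big N X L \<and>
         \<phi> \<in> graded_algebra_hom divisor_algebra divisor_gr (section_ring N X L) (section_ring_gr N X L) \<and>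
         inj_on \<phi> (carrier divisor_algebra))"
    using not_embeddable by (metis rfun_module_simps(1))
qed

end
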